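(* Let $k\geq 0$ and let $\mathcal{P}\subseteq\mathbb{Z}_{\geq0}$ satisfy $0\in\mathcal{P}$, $\mathcal{P}-2\neq\emptyset$ (i.e. $\mathcal{P}$ contains an element $\geq 2$), and $\gcd(\mathcal{P})=1$. For $n\ge 1$ let $\mathcal{F}_n$ be the set of functions $f:[n]\to[n]$ with $|f^{-1}(x)|\in\mathcal{P}$ for every $x\in[n]$, and let $\mathcal{Q}_n$ be the set of partial functions $f$ on $[n]$ (functions from some subset $S\subseteq[n]$ to $[n]$) with $|f^{-1}(x)|\in\mathcal{P}$ for every $x\in[n]$. Then, as $n\to\infty$, $$\frac{\sum_{f\in\mathcal{F}_n}|f^k([n])|}{|\mathcal{F}_n|}\sim n\Big(1-\frac{\tau_k^\mathcal{P}}{\tau_\mathcal{P}}\Big)\qquad\text{and}\qquad \frac{\sum_{f\in\mathcal{Q}_n}|f^k([n])|}{|\mathcal{Q}_n|}\sim n\Big(1-\frac{\tau_k^\mathcal{P}}{\tau_\mathcal{P}}\Big).$$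
   Context: $[n]=\{1,\dots,n\}$. For $\mathcal{P}\subseteq\mathbb{Z}_{\ge0}$, $e_\mathcal{P}(z)=\sum_{n\in\mathcal{P}}z^n/n!$ (an entire function), and $\mathcal{P}-i=\{n-i: n\in\mathcal{P},\,n\ge i\}$. $\tau_\mathcal{P}$ is the unique $\tau\in\mathbb{R}_{>0}$ with $e_\mathcal{P}(\tau)-\tau e_\mathcal{P}'(\tau)=0$, and $\rho_\mathcal{P}=\tau_\mathcal{P}/e_\mathcal{P}(\tau_\mathcal{P})$. The numbers $\tau_k^\mathcal{P}$ are defined recursively by $\tau_0^\mathcal{P}=0$ and $\tau_{k+1}^\mathcal{P}=\rho_\mathcal{P}\,e_\mathcal{P}(\tau_k^\mathcal{P})$ for $k\ge0$. For a (partial) function $f$, $f^k([n])$ is the set of $y$ such that $y=f^k(x)$ for some $x$ at which $f^k$ is defined. $a_n\sim b_n$ means $a_n/b_n\to1$. *)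

theory Defs
  imports "HOL-Analysis.Analysis" "HOL-Library.Landau_Symbols"
begin

definition eP :: "nat set \<Rightarrow> real \<Rightarrow> real" where
  "eP P z = (\<Sum>n. if n \<in> P then z ^ n / fact n else 0)"

definition tauP :: "nat set \<Rightarrow> real" where
  "tauP P = (THE t. t > 0 \<and> eP P t - t * deriv (eP P) t = 0)"

definition rhoP :: "nat set \<Rightarrow> real" where
  "rhoP P = tauP P / eP P (tauP P)"

fun tauk :: "nat set \<Rightarrow> nat \<Rightarrow> real" where
  "tauk P 0 = 0"
| "tauk P (Suc k) = rhoP P * eP P (tauk P k)"

definition partial_funs :: "nat \<Rightarrow> (nat \<rightharpoonup> nat) set" where
  "partial_funs n = {f. dom f \<subseteq> {1..n} \<and> ran f \<subseteq> {1..n}}"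

definition preimage_card :: "(nat \<rightharpoonup> nat) \<Rightarrow> nat \<Rightarrow> nat" where
  "preimage_card f x = card {y. f y = Some x}"

definition QP :: "nat set \<Rightarrow> nat \<Rightarrow> (nat \<rightharpoonup> nat) set" where
  "QP P n = {f \<in> partial_funs n. \<forall>x\<in>{1..n}. preimage_card f x \<in> P}"

definition FP :: "nat set \<Rightarrow> nat \<Rightarrow> (nat \<rightharpoonup> nat) set" where
  "FP P n = {f \<in> QP P n. dom f = {1..n}}"

fun map_iter :: "nat \<Rightarrow> (nat \<rightharpoonup> nat) \<Rightarrow> (nat \<rightharpoonup> nat)" where
  "map_iter 0 f = Some"
| "map_iter (Suc k) f = f \<circ>\<^sub>m map_iter k f"

definition iter_image :: "nat \<Rightarrow> (nat \<rightharpoonup> nat) \<Rightarrow> nat \<Rightarrow> nat set" where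
  "iter_image k f n = {y. \<exists>x\<in>{1..n}. map_iter k f x = Some y}"

definition avg_image :: "nat \<Rightarrow> (nat \<rightharpoonup> nat) set \<Rightarrow> nat \<Rightarrow> real" where
  "avg_image k A n = (\<Sum>f\<in>A. real (card (iter_image k f n))) / real (card A)"

end

theory Submission
  imports Defs "HOL-Number_Theory.Cong" "HOL-Real_Asymp.Real_Asymp"
begin

text \<open>A point \<open>y\<close> lies outside $f^k([n])$ iff its tree of iterated preimages has fewer than \<open>k\<close>
  levels. Exposing this tree level by level turns the number of pairs $(f, y)$ with this property into
  a recursion over the sizes of the levels, whose coefficients are $s$-th coefficients of powers of the
  probability generating function $e_P(\tau z)/e_P(\tau)$, of mean 1, times ratios
  $B_{n-a}(n-b)/B_n(n)$. Here $B_n(j)$ is the $j$-th coefficient of the $n$-th power, multiplied by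
  $e^{\tau z}$ in the case of partial functions. Once these ratios are known to tend to 1 for
  fixed $a$ and $b$, dominated convergence shows that the fraction of such pairs tends to the
  extinction probability $q_k$ of a branching process, $q_0 = 0$,
  $q_{k+1} = e_P(\tau q_k)/e_P(\tau)$, that is $q_k = \tau_k/\tau$.

  The ratio limit needs no local limit theorem: up to the factor $p_d$, the ratio
  $B_{n-1}(j-d)/B_n(j)$ is the expected frequency of the value $d$ among $n$ independent summands with
  distribution $p$ conditioned on the sum \<open>j\<close>. Unconditionally this frequency deviates from
  $p_d$ only with exponentially small probability, and the condition has subexponential probability.\<close>

subsection \<open>Power series with nonnegative coefficients\<close>

lemma fps_mult_nonneg:
  fixes f g :: "real fps"
  assumes "\<And>i. fps_nth f i \<ge> 0" "\<And>i. fps_nth g i \<ge> 0"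
  shows "fps_nth (f * g) i \<ge> 0"
  unfolding fps_mult_nth by (intro sum_nonneg mult_nonneg_nonneg assms)

lemma fps_power_nonneg:
  fixes f :: "real fps"
  assumes "\<And>i. fps_nth f i \<ge> 0"
  shows "fps_nth (f ^ n) i \<ge> 0"
proof (induction n arbitrary: i)
  case (Suc n)
  then show ?case using fps_mult_nonneg[OF assms, of "f ^ n" i] by simp
qed (simp add: fps_one_nth)

lemma fps_mult_nth_ge:
  fixes f g :: "real fps"
  assumes "\<And>i. fps_nth f i \<ge> 0" "\<And>i. fps_nth g i \<ge> 0"
  shows "fps_nth f i * fps_nth g j \<le> fps_nth (f * g) (i + j)"
proof -
  have "(\<Sum>k\<in>{i}. fps_nth f k * fps_nth g (i + j - k)) \<le> (\<Sum>k=0..i+j. fps_nth f k * fps_nth g (i + j - k))"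
    by (intro sum_mono2) (auto intro!: mult_nonneg_nonneg assms)
  then show ?thesis by (simp add: fps_mult_nth)
qed

lemma fps_conv_radius_mult_infinity:
  fixes f g :: "real fps"
  assumes "fps_conv_radius f = \<infinity>" "fps_conv_radius g = \<infinity>"
  shows "fps_conv_radius (f * g) = \<infinity>"
  using fps_conv_radius_mult[of f g] assms by simp

lemma fps_conv_radius_power_infinity:
  fixes f :: "real fps"
  assumes "fps_conv_radius f = \<infinity>"
  shows "fps_conv_radius (f ^ n) = \<infinity>"
  using fps_conv_radius_power[of f n] assms by simp

lemma fps_term_le_eval:
  fixes f :: "real fps"
  assumes "\<And>i. fps_nth f i \<ge> 0" "fps_conv_radius f = \<infinity>" "x \<ge> 0"
  shows "fps_nth f j * x ^ j \<le> eval_fps f x"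
proof -
  have s: "(\<lambda>n. fps_nth f n * x ^ n) sums eval_fps f x"
    by (rule sums_eval_fps) (use assms in simp)
  have "(\<Sum>n\<in>{j}. fps_nth f n * x ^ n) \<le> (\<Sum>n. fps_nth f n * x ^ n)"
    by (rule sum_le_suminf) (use s assms in \<open>auto simp: sums_iff\<close>)
  then show ?thesis using s by (simp add: sums_iff)
qed

lemma fps_nth_le_eval:
  fixes f :: "real fps"
  assumes "\<And>i. fps_nth f i \<ge> 0" "fps_conv_radius f = \<infinity>"
  shows "fps_nth f j \<le> eval_fps f 1"
  using fps_term_le_eval[OF assms, of 1 j] by simp

text \<open>Remainders modulo the least positive member \<open>h\<close> of \<open>I\<close> stay in
  \<open>I\<close>, so \<open>h\<close> divides every element of \<open>P\<close> and hence the gcd.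
  Aperiodicity enters through this lemma, both for supports of powers and for index shifts.\<close>

lemma int_subgroup_eq_UNIV:
  fixes I :: "int set" and P :: "nat set"
  assumes diff: "\<And>a b. a \<in> I \<Longrightarrow> b \<in> I \<Longrightarrow> a - b \<in> I"
    and P: "\<And>d. d \<in> P \<Longrightarrow> int d \<in> I" and gcd: "Gcd P = 1"
  shows "I = UNIV"
proof -
  obtain d where d: "d \<in> P" "d > 0"
    using gcd by (metis Gcd_0_iff gr0I singletonD subsetI zero_neq_one singletonI)
  define h where "h = (LEAST h::nat. h > 0 \<and> int h \<in> I)"
  have h: "h > 0" "int h \<in> I"
    using LeastI[of "\<lambda>h. h > 0 \<and> int h \<in> I" d] d P unfolding h_def by auto
  have zero: "0 \<in> I" using diff[OF h(2) h(2)] by simp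
  have neg: "- a \<in> I" if "a \<in> I" for a using diff[OF zero that] by simp
  have add: "a + b \<in> I" if "a \<in> I" "b \<in> I" for a b using diff[OF that(1) neg[OF that(2)]] by simp
  have multn: "int n * a \<in> I" if "a \<in> I" for a n
    by (induction n) (use zero add that in \<open>auto simp: algebra_simps\<close>)
  have mult: "z * int h \<in> I" for z
  proof (cases "z \<ge> 0")
    case True then show ?thesis using multn[OF h(2), of "nat z"] by simp
  next
    case False then show ?thesis using neg[OF multn[OF h(2), of "nat (- z)"]] by simp
  qed
  have "h dvd e" if "e \<in> P" for e
  proof (rule ccontr)
    assume "\<not> h dvd e"
    then have "e mod h > 0" "e mod h < h" using h(1) by (auto simp: dvd_eq_mod_eq_0)
    moreover have "int (e mod h) \<in> I"
      using diff[OF P[OF that] mult[of "int (e div h)"]]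
      by (metis of_nat_mod minus_div_mult_eq_mod of_nat_mult of_nat_diff div_times_less_eq_dividend zdiv_int)
    ultimately show False using not_less_Least[of "e mod h" "\<lambda>h. h > 0 \<and> int h \<in> I"] h_def by auto
  qed
  then have "h dvd 1" using Gcd_greatest[of P h] gcd by metis
  then show ?thesis using mult by auto
qed

subsection \<open>Ratio limits for coefficients of large powers\<close>

text \<open>A critical offspring law \<open>p\<close> with support \<open>P\<close> and entire
  generating function. The prefactor \<open>A\<close> covers total functions (\<open>A = 1\<close>)
  and partial functions (an exponential series) at once.\<close>

locale offspring =
  fixes P :: "nat set" and p A :: "real fps"
  assumes nonneg: "\<And>i. fps_nth p i \<ge> 0" and supp: "\<And>i. fps_nth p i > 0 \<longleftrightarrow> i \<in> P"
    and zero: "0 \<in> P" and two: "\<exists>m\<in>P. m \<ge> 2" and gcd: "Gcd P = 1"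
    and rad: "fps_conv_radius p = \<infinity>" and radA: "fps_conv_radius A = \<infinity>"
    and mass: "eval_fps p 1 = 1" and mean: "eval_fps (fps_deriv p) 1 = 1"
    and nonnegA: "\<And>i. fps_nth A i \<ge> 0" and A0: "fps_nth A 0 > 0"
begin

definition B :: "nat \<Rightarrow> nat \<Rightarrow> real" where "B n j = fps_nth (A * p ^ n) j"

lemma B_nonneg: "B n j \<ge> 0"
  unfolding B_def by (intro fps_mult_nonneg fps_power_nonneg nonneg nonnegA)

lemma B_add: "B (r + n) j = (\<Sum>i=0..j. fps_nth (p ^ r) i * B n (j - i))"
proof -
  have "A * p ^ (r + n) = p ^ r * (A * p ^ n)" by (simp add: power_add)
  then show ?thesis unfolding B_def by (simp only: fps_mult_nth[of "p ^ r"])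
qed

lemma B_Suc: "B (Suc n) j = (\<Sum>i=0..j. fps_nth p i * B n (j - i))"
  using B_add[of 1 n j] by simp

section \<open>Exponential tilting of the frequency of one value\<close>

definition tilt :: "nat \<Rightarrow> real \<Rightarrow> real fps" where
  "tilt d s = p + fps_const ((exp s - 1) * fps_nth p d) * fps_X ^ d"

lemma tilt_nth: "fps_nth (tilt d s) i = fps_nth p i * (if i = d then exp s else 1)"
  by (simp add: tilt_def algebra_simps)

lemma eval_tilt: "eval_fps (tilt d s) 1 = 1 + (exp s - 1) * fps_nth p d"
  unfolding tilt_def
  by (subst eval_fps_add)
     (use rad mass fps_conv_radius_mult_infinity[of "fps_const ((exp s - 1) * fps_nth p d)" "fps_X ^ d"]
       in \<open>auto simp: eval_fps_mult\<close>)

lemma rad_tilt: "fps_conv_radius (tilt d s) = \<infinity>"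
  using fps_conv_radius_add[of p "fps_const ((exp s - 1) * fps_nth p d) * fps_X ^ d"] rad
    fps_conv_radius_mult_infinity[of "fps_const ((exp s - 1) * fps_nth p d)" "fps_X ^ d"]
  unfolding tilt_def by simp

text \<open>A nonnegative coefficient is at most the value of the series at 1. The power on the
  right is the moment generating function of the number of summands equal to
  \<open>d\<close>.\<close>

lemma tilt_upper: "fps_nth (A * tilt d s ^ n) j \<le> eval_fps A 1 * (1 + (exp s - 1) * fps_nth p d) ^ n"
proof -
  have nn: "fps_nth (tilt d s) i \<ge> 0" for i using nonneg by (simp add: tilt_nth)
  have "fps_nth (A * tilt d s ^ n) j \<le> eval_fps (A * tilt d s ^ n) 1"
    by (intro fps_nth_le_eval fps_mult_nonneg fps_power_nonneg nn nonnegA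
        fps_conv_radius_mult_infinity fps_conv_radius_power_infinity rad_tilt radA)
  then show ?thesis
    by (simp add: eval_fps_mult eval_fps_power fps_conv_radius_power_infinity rad_tilt radA eval_tilt)
qed

text \<open>The tilted coefficient is $\sum_i w_i e^{si}$, where $w_i$ is the part of $B_n(j)$ with exactly
  $i$ summands equal to $d$; summing the tangent line bound
  $e^{si} \geq e^{s\lambda}(1 + s(i - \lambda))$ against $w_i$ gives the right-hand side.\<close>

lemma tilt_lower:
  "fps_nth (A * tilt d s ^ n) j \<ge>
     exp (s * l) * ((1 - s * l) * B n j + s * n * fps_nth p d * fps_nth (fps_X ^ d * (A * p ^ (n - 1))) j)"
proof (induction n arbitrary: j l)
  case 0
  have "exp (s * l) * (1 - s * l) \<le> 1"
    using exp_ge_add_one_self[of "- (s * l)"] by (simp add: exp_minus field_simps)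
  then show ?case using mult_right_mono[OF _ nonnegA[of j], of "exp (s * l) * (1 - s * l)" 1]
    by (simp add: B_def mult_ac)
next
  case (Suc n)
  let ?G = "\<lambda>n. fps_X ^ d * (A * p ^ n)"
  let ?p = "fps_nth p" let ?a = "\<lambda>i::nat. if i = d then 1 else (0::real)"
  have "A * tilt d s ^ Suc n = tilt d s * (A * tilt d s ^ n)" by simp
  then have "fps_nth (A * tilt d s ^ Suc n) j =
      (\<Sum>i=0..j. ?p i * exp (s * ?a i) * fps_nth (A * tilt d s ^ n) (j - i))"
    by (simp only: fps_mult_nth[of "tilt d s"], intro sum.cong) (auto simp: tilt_nth)
  \<comment> \<open>The induction hypothesis is used at \<open>l - 1\<close> if the first summand
    equals \<open>d\<close> and at \<open>l\<close> otherwise; this absorbs the factor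
    \<open>exp s\<close> into \<open>exp (s * l)\<close>.\<close>
  also have "\<dots> \<ge> (\<Sum>i=0..j. ?p i * exp (s * ?a i) * (exp (s * (l - ?a i)) *
      ((1 - s * (l - ?a i)) * B n (j - i) + s * n * ?p d * fps_nth (?G (n - 1)) (j - i))))"
    by (intro sum_mono mult_left_mono Suc.IH mult_nonneg_nonneg nonneg) auto
  also have "(\<Sum>i=0..j. ?p i * exp (s * ?a i) * (exp (s * (l - ?a i)) *
      ((1 - s * (l - ?a i)) * B n (j - i) + s * n * ?p d * fps_nth (?G (n - 1)) (j - i)))) =
     (\<Sum>i=0..j. exp (s * l) * ((1 - s * l) * (?p i * B n (j - i)) + s * (if i = d then ?p d * B n (j - d) else 0)
        + s * n * ?p d * (?p i * fps_nth (?G (n - 1)) (j - i))))"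
    by (intro sum.cong refl) (auto simp: algebra_simps exp_diff)
  also have "\<dots> = exp (s * l) * ((1 - s * l) * B (Suc n) j + s * (?p d * fps_nth (?G n) j)
        + s * n * ?p d * fps_nth (p * ?G (n - 1)) j)"
    by (simp add: sum_distrib_left[symmetric] sum.distrib B_Suc fps_mult_nth[of p] fps_X_power_mult_nth)
       (auto simp: B_def)
  \<comment> \<open>For \<open>n = 0\<close> the truncated \<open>n - 1\<close> is harmless, because
    the factor \<open>n\<close> makes both sides vanish.\<close>
  also have "real n * fps_nth (p * ?G (n - 1)) j = n * fps_nth (?G n) j"
    by (cases n) (simp_all add: mult_ac)
  then have "exp (s * l) * ((1 - s * l) * B (Suc n) j + s * (?p d * fps_nth (?G n) j)
        + s * n * ?p d * fps_nth (p * ?G (n - 1)) j) = 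
     exp (s * l) * ((1 - s * l) * B (Suc n) j + s * real (Suc n) * ?p d * fps_nth (?G (Suc n - 1)) j)"
    by (simp add: distrib_left distrib_right mult.assoc mult.left_commute[of "real n"])
  finally show ?case .
qed

text \<open>Here \<open>m\<close> is the conditional mean of the number of summands equal to
  \<open>d\<close>. Taking \<open>l = m\<close> in \<open>tilt_lower\<close> cancels the linear
  terms, which amounts to Jensen's inequality.\<close>

lemma tilt_bound:
  assumes "B n j > 0" "d \<le> j" "n > 0"
  defines "m \<equiv> real n * fps_nth p d * B (n - 1) (j - d) / B n j"
  shows "B n j * exp (s * m) \<le> eval_fps A 1 * exp (n * (fps_nth p d * (exp s - 1)))"
proof -
  have e: "n * fps_nth p d * fps_nth (fps_X ^ d * (A * p ^ (n - 1))) j = m * B n j"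
    using assms by (simp add: fps_X_power_mult_nth) (simp add: B_def)
  have "B n j * exp (s * m) = exp (s * m) * ((1 - s * m) * B n j + s * (m * B n j))"
    by (simp add: algebra_simps)
  also have "\<dots> \<le> fps_nth (A * tilt d s ^ n) j"
    using tilt_lower[of s m n j d] e by (simp add: mult.assoc)
  also have "\<dots> \<le> eval_fps A 1 * (1 + (exp s - 1) * fps_nth p d) ^ n" by (rule tilt_upper)
  also have "\<dots> \<le> eval_fps A 1 * exp ((exp s - 1) * fps_nth p d) ^ n"
  proof (intro mult_left_mono power_mono)
    show "1 + (exp s - 1) * fps_nth p d \<le> exp ((exp s - 1) * fps_nth p d)"
      by (rule exp_ge_add_one_self)
    have "fps_nth p d \<le> 1" using fps_nth_le_eval[OF nonneg rad] mass by simp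
    then have "0 \<le> (1 - fps_nth p d) + exp s * fps_nth p d"
      using nonneg[of d] by simp
    then show "0 \<le> 1 + (exp s - 1) * fps_nth p d" by (simp add: algebra_simps)
    show "0 \<le> eval_fps A 1" using fps_nth_le_eval[OF nonnegA radA, of 0] A0 by simp
  qed
  finally show ?thesis by (simp add: exp_of_nat_mult[symmetric] mult_ac)
qed

section \<open>Subexponential lower bounds for coefficients of powers\<close>

lemma pow_le_1: "fps_nth (p ^ n) j \<le> 1"
  using fps_nth_le_eval[OF fps_power_nonneg[OF nonneg] fps_conv_radius_power_infinity[OF rad]]
  by (simp add: eval_fps_power rad mass)

lemma pow_add_ge: "fps_nth (p ^ n) i * fps_nth (p ^ m) j \<le> fps_nth (p ^ (n + m)) (i + j)"
  unfolding power_add by (intro fps_mult_nth_ge fps_power_nonneg nonneg)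

lemma pow_mult_ge: "fps_nth (p ^ n) i ^ k \<le> fps_nth (p ^ (k * n)) (k * i)"
proof (induction k)
  case (Suc k)
  have "fps_nth (p ^ n) i ^ Suc k \<le> fps_nth (p ^ n) i * fps_nth (p ^ (k * n)) (k * i)"
    using mult_left_mono[OF Suc fps_power_nonneg[OF nonneg, of n i]] by simp
  also have "\<dots> \<le> fps_nth (p ^ (n + k * n)) (i + k * i)" by (rule pow_add_ge)
  finally show ?case by simp
qed simp

text \<open>Modulo \<open>d\<close>, subtracting \<open>g'\<close> is the same as adding
  \<open>d - 1\<close> copies of it, so the attained residues are closed under differences.\<close>

lemma residue_attained:
  assumes "d > 0"
  shows "\<exists>g l. [int g = z] (mod int d) \<and> fps_nth (p ^ l) g > 0"
proof -
  define I where "I = {z. \<exists>g l. [int g = z] (mod int d) \<and> fps_nth (p ^ l) g > 0}"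
  have "I = UNIV"
  proof (rule int_subgroup_eq_UNIV[OF _ _ gcd])
    fix a b assume "a \<in> I" "b \<in> I"
    then obtain g l g' l' where *: "[int g = a] (mod int d)" "fps_nth (p ^ l) g > 0"
      "[int g' = b] (mod int d)" "fps_nth (p ^ l') g' > 0" by (auto simp: I_def)
    have "[int (g + (d - 1) * g') = a + (int d - 1) * b] (mod int d)"
      using * assms by (auto simp: of_nat_diff intro!: cong_add cong_mult)
    also have "a + (int d - 1) * b = (a - b) + int d * b" by (simp add: algebra_simps)
    also have "[\<dots> = a - b] (mod int d)" by (simp add: cong_def)
    finally have "[int (g + (d - 1) * g') = a - b] (mod int d)" .
    moreover have "0 < fps_nth (p ^ l) g * fps_nth (p ^ ((d - 1) * l')) ((d - 1) * g')"
      using * by (intro mult_pos_pos less_le_trans[OF _ pow_mult_ge]) auto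
    then have "0 < fps_nth (p ^ (l + (d - 1) * l')) (g + (d - 1) * g')"
      using pow_add_ge less_le_trans by blast
    ultimately show "a - b \<in> I" unfolding I_def by blast
  next
    fix e assume "e \<in> P"
    then have "[int e = int e] (mod int d) \<and> fps_nth (p ^ 1) e > 0" using supp[of e] by simp
    then show "int e \<in> I" unfolding I_def by blast
  qed
  then have "z \<in> I" by simp
  then show ?thesis unfolding I_def by blast
qed

text \<open>A bounded block of \<open>l i\<close> summands fixes the residue of \<open>r\<close>
  modulo \<open>d\<close>; the rest of \<open>r\<close> is filled with \<open>q\<close> summands
  equal to \<open>d\<close> and with zeros. As \<open>d \<ge> 2\<close>, at most
  \<open>r / 2\<close> copies of \<open>d\<close> are needed, so \<open>r\<close> may be almost as
  large as \<open>2 * L\<close>.\<close>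

lemma pow_lower:
  obtains c R where "0 < c" "c \<le> 1" "\<And>r L. R \<le> r \<Longrightarrow> r + 2 * R \<le> 2 * L \<Longrightarrow> c ^ Suc L \<le> fps_nth (p ^ L) r"
proof -
  obtain d where d: "d \<in> P" "d \<ge> 2" using two by auto
  have "\<forall>i. \<exists>g l. [int g = int i] (mod int d) \<and> fps_nth (p ^ l) g > 0"
    using residue_attained d by auto
  then obtain g l where gl: "\<And>i. [int (g i) = int i] (mod int d)" "\<And>i. fps_nth (p ^ l i) (g i) > 0"
    by metis
  define R where "R = (\<Sum>i<d. g i + l i)"
  define S where "S = insert (fps_nth p 0) (insert (fps_nth p d) ((\<lambda>i. fps_nth (p ^ l i) (g i)) ` {..<d}))"
  define c where "c = Min S"
  have S: "finite S" "S \<noteq> {}" unfolding S_def by auto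
  have c0: "c > 0" unfolding c_def using S gl supp d zero by (auto simp: S_def)
  have c1: "c \<le> fps_nth p 0" "c \<le> fps_nth p d" "i < d \<Longrightarrow> c \<le> fps_nth (p ^ l i) (g i)" for i
    unfolding c_def by (rule Min_le[OF S(1)], simp add: S_def)+
  have c2: "c \<le> 1" using c1(1) pow_le_1[of 1 0] by simp
  have "c ^ Suc L \<le> fps_nth (p ^ L) r" if "R \<le> r" "r + 2 * R \<le> 2 * L" for r L
  proof -
    define i where "i = r mod d"
    have i: "i < d" using d unfolding i_def by simp
    have "g i + l i \<le> R" unfolding R_def using i by (intro member_le_sum) auto
    then have le: "g i \<le> r" "l i \<le> R" using that by auto
    have "[g i = r] (mod d)" using gl(1)[of i] unfolding i_def by (simp add: cong_int_iff)
    then have "d dvd r - g i" using le by (metis cong_altdef_nat cong_sym)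
    then obtain q where q: "r - g i = d * q" by auto
    then have r: "r = g i + (q * d + 0)" using le by (simp add: mult.commute)
    have "2 * q \<le> d * q" using d by simp
    then have "2 * q \<le> r" using q by linarith
    then have "l i + q \<le> L" using le that by linarith
    then have L: "L = l i + (q * 1 + (L - l i - q) * 1)" by simp
    \<comment> \<open>The residue block contributes one factor \<open>c\<close> even when
      \<open>l i = 0\<close>, hence the exponent \<open>Suc L\<close>.\<close>
    have "c ^ Suc L \<le> c ^ (1 + (q + (L - l i - q)))"
    proof (rule power_decreasing)
      show "1 + (q + (L - l i - q)) \<le> Suc L" using \<open>l i + q \<le> L\<close> by linarith
    qed (use c0 c2 in auto)
    also have "\<dots> = c * (c ^ q * c ^ (L - l i - q))" by (simp add: power_add)
    also have "\<dots> \<le> fps_nth (p ^ l i) (g i) * (fps_nth (p ^ (q * 1)) (q * d) * fps_nth (p ^ ((L - l i - q) * 1)) ((L - l i - q) * 0))"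
      using c0 c1 i by (intro mult_mono order_trans[OF power_mono pow_mult_ge] mult_nonneg_nonneg
          fps_power_nonneg nonneg) auto
    also have "\<dots> \<le> fps_nth (p ^ l i) (g i) * (fps_nth (p ^ (q * 1 + (L - l i - q) * 1)) (q * d + (L - l i - q) * 0))"
      by (intro mult_left_mono pow_add_ge fps_power_nonneg nonneg)
    also have "\<dots> \<le> fps_nth (p ^ (l i + (q * 1 + (L - l i - q) * 1))) (g i + (q * d + (L - l i - q) * 0))"
      by (rule pow_add_ge)
    also have "\<dots> = fps_nth (p ^ L) r" using L r by simp
    finally show ?thesis .
  qed
  then show ?thesis using that c0 c2 by blast
qed

text \<open>At \<open>s = 0\<close> the expression equals 1 and has derivative
  \<open>v - (v + \<epsilon>)\<close>, since the mean is 1. The signs \<open>v = 1\<close> and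
  \<open>v = - 1\<close> serve the upper and the lower tail.\<close>

lemma chernoff:
  assumes "\<bar>v\<bar> = 1" "\<epsilon> > 0"
  shows "\<exists>s>0. eval_fps p (exp (v * s)) * exp (- (v + \<epsilon>) * s) < 1"
proof -
  have D: "((\<lambda>s. eval_fps p (exp (v * s)) * exp (- (v + \<epsilon>) * s)) has_real_derivative - \<epsilon>) (at 0)"
  proof -
    have "(eval_fps p has_real_derivative eval_fps (fps_deriv p) (exp (v * 0))) (at (exp (v * 0)))"
      by (rule has_field_derivative_eval_fps) (simp add: rad)
    moreover have "((\<lambda>s. exp (v * s)) has_real_derivative v) (at 0)"
      by (auto intro!: derivative_eq_intros)
    ultimately have "((\<lambda>s. eval_fps p (exp (v * s))) has_real_derivative eval_fps (fps_deriv p) (exp (v * 0)) * v) (at 0)"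
      by (rule DERIV_chain2)
    then show ?thesis using mass mean
      by (auto intro!: derivative_eq_intros simp: algebra_simps)
  qed
  from DERIV_neg_dec_right[OF D] assms obtain e where "e > 0"
    "\<And>h. 0 < h \<Longrightarrow> h < e \<Longrightarrow> eval_fps p (exp (v * (0 + h))) * exp (- (v + \<epsilon>) * (0 + h)) < eval_fps p (exp (v * 0)) * exp (- (v + \<epsilon>) * 0)"
    by auto
  from this(1) this(2)[of "e / 2"] show ?thesis using mass by (intro exI[of _ "e / 2"]) simp
qed

text \<open>Both tails have mass below 1/4, so mass above 1/2 falls on at most
  \<open>2 * n + 1\<close> values, and some value receives its share.\<close>

lemma window:
  fixes \<epsilon> :: real
  assumes "0 < \<epsilon>" "\<epsilon> \<le> 1"
  shows "eventually (\<lambda>n. \<exists>j. \<bar>real j - real n\<bar> \<le> \<epsilon> * n \<and> 1 / (4 * real n + 4) \<le> fps_nth (p ^ n) j) at_top"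
proof -
  define \<psi> where "\<psi> = (\<lambda>v s. eval_fps p (exp (v * s)) * exp (- (v + \<epsilon>) * s))"
  obtain s where s: "s > 0" "\<psi> 1 s < 1" using chernoff[of 1 \<epsilon>] assms by (auto simp: \<psi>_def)
  obtain t where t: "t > 0" "\<psi> (- 1) t < 1" using chernoff[of "- 1" \<epsilon>] assms by (auto simp: \<psi>_def)
  have pos: "\<psi> v u \<ge> 0" for v u
  proof -
    have "(\<lambda>n. fps_nth p n * exp (v * u) ^ n) sums eval_fps p (exp (v * u))"
      by (rule sums_eval_fps) (simp add: rad)
    then have "0 \<le> eval_fps p (exp (v * u))"
      by (rule sums_le[OF _ sums_zero, rotated]) (simp add: nonneg)
    then show ?thesis by (simp add: \<psi>_def)
  qed
  have ev: "eventually (\<lambda>n. x ^ n < 1 / 4) at_top" if "0 \<le> x" "x < 1" for x :: real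
    using order_tendstoD(2)[OF LIMSEQ_realpow_zero[OF that], of "1/4"] by simp
  show ?thesis using ev[OF pos s(2)] ev[OF pos t(2)]
  proof eventually_elim
    case (elim n)
    show ?case
    proof (rule ccontr)
      assume no: "\<not> ?thesis"
      define W where "W = {j. \<bar>real j - real n\<bar> \<le> \<epsilon> * n}"
      have "\<epsilon> * real n \<le> 1 * real n" using assms by (intro mult_right_mono) auto
      then have W: "W \<subseteq> {..2 * n}" unfolding W_def by auto
      then have fW: "finite W" by (rule finite_subset) simp
      let ?a = "fps_nth (p ^ n)"
      have a0: "?a j \<ge> 0" for j by (intro fps_power_nonneg nonneg)
      have S: "(\<lambda>j. ?a j * y ^ j) sums (eval_fps p y ^ n)" for y
        using sums_eval_fps[of y "p ^ n"] by (simp add: fps_conv_radius_power_infinity rad eval_fps_power)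
      \<comment> \<open>This is the expectation of the exponential of
        \<open>u * (v * (j - n) - \<epsilon> * n)\<close>, with \<open>j\<close> the sum of
        \<open>n\<close> independent summands.\<close>
      have tail: "(\<lambda>j. ?a j * exp (u * (v * (real j - n) - \<epsilon> * n))) sums (\<psi> v u ^ n)" for v u
      proof -
        have "(\<lambda>j. exp (- (v + \<epsilon>) * u) ^ n * (?a j * exp (v * u) ^ j)) sums (exp (- (v + \<epsilon>) * u) ^ n * eval_fps p (exp (v * u)) ^ n)"
          by (intro sums_mult S)
        moreover have "exp (- (v + \<epsilon>) * u) ^ n * (?a j * exp (v * u) ^ j) = ?a j * exp (u * (v * (real j - n) - \<epsilon> * n))" for j
          by (simp add: exp_of_nat_mult[symmetric] exp_add[symmetric]) (simp add: algebra_simps exp_add[symmetric])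
        ultimately show ?thesis by (simp only: \<psi>_def power_mult_distrib mult.commute[of "eval_fps p (exp (v * u)) ^ n"])
      qed
      have "(\<lambda>j. if j \<in> W then ?a j else 0) sums (\<Sum>j\<in>W. ?a j)"
        by (rule sums_If_finite_set[OF fW])
      then have total: "(\<lambda>j. (if j \<in> W then ?a j else 0) + ?a j * exp (s * (1 * (real j - n) - \<epsilon> * n))
          + ?a j * exp (t * ((- 1) * (real j - n) - \<epsilon> * n))) sums (
          (\<Sum>j\<in>W. ?a j) + \<psi> 1 s ^ n + \<psi> (- 1) t ^ n)"
        by (intro sums_add tail)
      \<comment> \<open>Outside \<open>W\<close> one of the two exponents is positive, and the
        corresponding term alone dominates the coefficient.\<close>
      have le: "?a j \<le> (if j \<in> W then ?a j else 0) + ?a j * exp (s * (1 * (real j - n) - \<epsilon> * n))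
          + ?a j * exp (t * ((- 1) * (real j - n) - \<epsilon> * n))" for j
      proof -
        have *: "?a j \<le> ?a j * exp (u * x)" if "u > 0" "x > 0" for u x
          using that a0[of j] mult_left_mono[of 1 "exp (u * x)" "?a j"] by simp
        have 0: "0 \<le> ?a j * exp x" for x using a0 by simp
        consider "j \<in> W" | "1 * (real j - n) - \<epsilon> * n > 0" | "(- 1) * (real j - n) - \<epsilon> * n > 0"
          unfolding W_def by fastforce
        then show ?thesis
        proof cases
          case 1 then show ?thesis using 0 by (simp add: add_nonneg_nonneg)
        next
          case 2
          show ?thesis using *[OF s(1) 2] 0[of "t * ((- 1) * (real j - n) - \<epsilon> * n)"] a0[of j] by (smt (verit))
        next
          case 3
          show ?thesis using *[OF t(1) 3] 0[of "s * (1 * (real j - n) - \<epsilon> * n)"] a0[of j] by (smt (verit))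
        qed
      qed
      have one: "?a sums 1" using S[of 1] by (simp add: mass)
      have "1 \<le> (\<Sum>j\<in>W. ?a j) + \<psi> 1 s ^ n + \<psi> (- 1) t ^ n"
        by (rule sums_le[OF le one total])
      moreover have "(\<Sum>j\<in>W. ?a j) \<le> (\<Sum>j\<in>W. 1 / (4 * real n + 4))"
        using no unfolding W_def by (intro sum_mono less_imp_le) (metis mem_Collect_eq not_le)
      moreover have "card W \<le> 2 * n + 1" using card_mono[OF _ W] by simp
      then have "(\<Sum>j\<in>W. 1 / (4 * real n + 4)) \<le> 1 / 2"
        by (simp add: field_simps)
      ultimately show False using elim by linarith
    qed
  qed
qed

text \<open>\<open>window\<close> gives some good value \<open>j\<close>, not a prescribed one.
  About \<open>4 * \<delta> * N\<close> of the summands are therefore reserved to correct the sum to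
  exactly \<open>N + c\<close>; the correction \<open>r\<close> is close enough to \<open>L\<close>
  for \<open>pow_lower\<close>.\<close>

lemma pow_subexp:
  assumes "\<epsilon> > 0"
  shows "eventually (\<lambda>N. exp (- \<epsilon> * real N) \<le> fps_nth (p ^ N) (nat (int N + c))) at_top"
proof -
  obtain q R where q: "0 < q" "q \<le> 1" and
    R: "\<And>r L. R \<le> r \<Longrightarrow> r + 2 * R \<le> 2 * L \<Longrightarrow> q ^ Suc L \<le> fps_nth (p ^ L) r"
    using pow_lower by metis
  define K where "K = - ln q"
  have K: "K \<ge> 0" "q = exp (- K)" using q by (auto simp: K_def)
  \<comment> \<open>The bound 1/8 leaves about half of the summands for \<open>window\<close>; the
    other bound limits the cost \<open>q ^ Suc L\<close> to
    \<open>exp (- (\<epsilon> / 2) * N)\<close> up to a constant.\<close>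
  define \<delta> where "\<delta> = min (1/8) (\<epsilon> / (8 * (K + 1)))"
  have "\<delta> > 0" using K assms by (simp add: \<delta>_def)
  moreover have "\<delta> \<le> 1/8" unfolding \<delta>_def by (rule min.cobounded1)
  ultimately have \<delta>: "\<delta> > 0" "\<delta> \<le> 1/8" by auto
  have "\<delta> \<le> \<epsilon> / (8 * (K + 1))" unfolding \<delta>_def by (rule min.cobounded2)
  then have "K * \<delta> \<le> (K + 1) * (\<epsilon> / (8 * (K + 1)))" using K(1) \<delta>(1) by (intro mult_mono) auto
  also have "\<dots> = \<epsilon> / 8" using K(1) by (simp add: field_simps)
  finally have K\<delta>: "8 * (K * \<delta>) \<le> \<epsilon>" by simp
  obtain n0 where n0: "\<And>n. n \<ge> n0 \<Longrightarrow> \<exists>j. \<bar>real j - real n\<bar> \<le> \<delta> * n \<and> 1 / (4 * real n + 4) \<le> fps_nth (p ^ n) j"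
    using window[of \<delta>] \<delta> unfolding eventually_at_top_linorder by auto
  have "eventually (\<lambda>N. real N \<ge> 2 * (real n0 + 1)) at_top" by real_asymp
  moreover have "eventually (\<lambda>N. \<delta> * real N \<ge> real R * 2 + real_of_int \<bar>c\<bar> + 1) at_top"
    using \<delta> by real_asymp
  moreover have "eventually (\<lambda>N. exp (- (\<epsilon> / 2) * real N) \<le> exp (- 2 * K) / (4 * real N + 4)) at_top"
    using assms by real_asymp
  ultimately show ?thesis
  proof eventually_elim
    case (elim N)
    define L where "L = nat \<lceil>4 * \<delta> * N\<rceil>"
    have L: "4 * \<delta> * N \<le> L" "L \<le> 4 * \<delta> * N + 1" using \<delta> by (auto simp: L_def)
    have "\<delta> * N \<le> 1/8 * N" using \<delta> by (intro mult_right_mono) auto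
    then have LN: "real L \<le> real N / 2 + 1" using L by linarith
    have "real L \<le> real N" using LN elim(1) by simp
    moreover have "real n0 + real L \<le> real N" using LN elim(1) by (simp add: algebra_simps)
    ultimately have LN': "L \<le> N" "N - L \<ge> n0" by linarith+
    define n where "n = N - L"
    obtain j where j: "\<bar>real j - real n\<bar> \<le> \<delta> * n" "1 / (4 * real n + 4) \<le> fps_nth (p ^ n) j"
      using n0[of n] LN' n_def by auto
    have "\<delta> * n \<le> \<delta> * N" using \<delta> LN' n_def by simp
    then have jn: "\<bar>real j - real n\<bar> \<le> \<delta> * N" using j by linarith
    define r where "r = nat (int N + c - int j)"
    have nN: "real n = real N - real L" using LN' n_def by simp
    have pos: "real_of_int (int N + c - int j) \<ge> R" using jn nN L elim(2) by simp
    then have "int N + c - int j \<ge> 0" by linarith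
    then have rr: "real r = real N + real_of_int c - real j" unfolding r_def by simp
    have "R \<le> r" using pos rr by simp
    have "real (r + 2 * R) \<le> real (2 * L)" using rr jn nN L elim(2) by simp
    then have "r + 2 * R \<le> 2 * L" by linarith
    then have low: "q ^ Suc L \<le> fps_nth (p ^ L) r" using R \<open>R \<le> r\<close> by blast
    have "q ^ Suc L = exp (- K * (real L + 1))"
      unfolding K(2) exp_of_nat_mult[symmetric] by (simp add: algebra_simps)
    also have "\<dots> \<ge> exp (- K * (4 * \<delta> * N + 2))"
      using K L by (intro iffD2[OF exp_le_cancel_iff]) (simp add: mult_left_mono)
    finally have "q ^ Suc L \<ge> exp (- K * (4 * \<delta> * N + 2))" .
    moreover have "8 * (K * \<delta>) * N \<le> \<epsilon> * N" by (intro mult_right_mono K\<delta>) auto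
    then have "exp (- K * (4 * \<delta> * N + 2)) \<ge> exp (- (\<epsilon> / 2) * N) * exp (- 2 * K)"
      unfolding exp_add[symmetric] by (simp add: algebra_simps)
    ultimately have low2: "exp (- (\<epsilon> / 2) * N) * exp (- 2 * K) \<le> fps_nth (p ^ L) r" using low by linarith
    have "exp (- \<epsilon> * N) = exp (- (\<epsilon> / 2) * N) * exp (- (\<epsilon> / 2) * N)"
      unfolding exp_add[symmetric] by simp
    also have "\<dots> \<le> exp (- (\<epsilon> / 2) * N) * (exp (- 2 * K) / (4 * real N + 4))"
      by (intro mult_left_mono elim(3)) simp
    also have "\<dots> = 1 / (4 * real N + 4) * (exp (- (\<epsilon> / 2) * N) * exp (- 2 * K))" by simp
    also have "\<dots> \<le> 1 / (4 * real n + 4) * (exp (- (\<epsilon> / 2) * N) * exp (- 2 * K))"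
      using nN by (intro mult_right_mono divide_left_mono) auto
    also have "\<dots> \<le> fps_nth (p ^ n) j * fps_nth (p ^ L) r"
      using j low2 by (intro mult_mono fps_power_nonneg nonneg) auto
    also have "\<dots> \<le> fps_nth (p ^ (n + L)) (j + r)" by (rule pow_add_ge)
    also have "n + L = N" using LN' n_def by simp
    also have "j + r = nat (int N + c)" unfolding r_def using \<open>int N + c - int j \<ge> 0\<close> by linarith
    finally show ?case .
  qed
qed

lemma B_subexp:
  assumes "\<epsilon> > 0"
  shows "eventually (\<lambda>n. exp (- \<epsilon> * real n) \<le> B n (nat (int n + c))) at_top"
proof -
  have "eventually (\<lambda>n. exp (- (\<epsilon> / 2) * real n) \<le> fps_nth A 0) at_top"
    using assms A0 by real_asymp
  moreover have "eventually (\<lambda>n. exp (- (\<epsilon> / 2) * real n) \<le> fps_nth (p ^ n) (nat (int n + c))) at_top"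
    using pow_subexp[of "\<epsilon> / 2" c] assms by simp
  ultimately show ?thesis
  proof eventually_elim
    case (elim n)
    have "exp (- \<epsilon> * n) = exp (- (\<epsilon> / 2) * n) * exp (- (\<epsilon> / 2) * n)"
      unfolding exp_add[symmetric] by simp
    also have "\<dots> \<le> fps_nth A 0 * fps_nth (p ^ n) (nat (int n + c))"
      using elim nonnegA[of 0] by (intro mult_mono) auto
    also have "\<dots> \<le> B n (nat (int n + c))"
      using fps_mult_nth_ge[of A "p ^ n" 0] fps_power_nonneg nonneg nonnegA unfolding B_def by simp
    finally show ?case .
  qed
qed

text \<open>The quantity \<open>\<mu> n\<close> is the conditional mean frequency of the value
  \<open>d\<close>. Using \<open>tilt_bound\<close> with a small positive and a small negative tilt
  squeezes it to \<open>fps_nth p d\<close>.\<close>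

lemma B_ratio:
  assumes d: "d \<in> P"
  shows "(\<lambda>n. B (n - 1) (nat (int n + c) - d) / B n (nat (int n + c))) \<longlonglongrightarrow> 1"
proof -
  let ?p = "fps_nth p d"
  have p0: "?p > 0" using d supp by blast
  have p1: "?p \<le> 1" using pow_le_1[of 1 d] by simp
  define \<mu> where "\<mu> = (\<lambda>n. ?p * B (n - 1) (nat (int n + c) - d) / B n (nat (int n + c)))"
  have "\<mu> \<longlonglongrightarrow> ?p"
  proof (rule tendstoI)
    fix \<eta> :: real assume \<eta>: "\<eta> > 0"
    \<comment> \<open>With these choices \<open>2 * \<delta>\<close> and the quadratic error
      \<open>?p * s\<^sup>2\<close> are each at most \<open>s * \<eta> / 4\<close>, so division by
      \<open>s\<close> leaves an error of at most \<open>\<eta> / 2\<close>.\<close>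
    define s where "s = min 1 (\<eta> / 4)"
    have s: "s > 0" "s \<le> 1" "s \<le> \<eta> / 4" using \<eta> by (auto simp: s_def)
    define \<delta> where "\<delta> = s * \<eta> / 8"
    have \<delta>: "\<delta> > 0" using s \<eta> by (simp add: \<delta>_def)
    have up: "exp s - 1 \<le> s + s\<^sup>2" using exp_bound[of s] s by simp
    have "exp (- s) \<le> 1 / (1 + s)"
      using exp_ge_add_one_self[of s] s by (simp add: exp_minus field_simps)
    also have "\<dots> \<le> 1 - s + s\<^sup>2"
    proof -
      have "(1 - s + s\<^sup>2) * (1 + s) = 1 + s ^ 3" by (simp add: algebra_simps power2_eq_square power3_eq_cube)
      moreover have "s ^ 3 \<ge> 0" using s by simp
      ultimately show ?thesis using s by (simp add: divide_le_eq)
    qed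
    finally have dn: "exp (- s) - 1 \<le> - s + s\<^sup>2" by simp
    have "eventually (\<lambda>n. eval_fps A 1 \<le> exp (\<delta> * real n)) at_top" using \<delta> by real_asymp
    moreover have "eventually (\<lambda>n. int d \<le> int n + c \<and> n > 0) at_top"
      using eventually_ge_at_top[of "nat (int d - c) + 1"] by eventually_elim linarith
    ultimately show "eventually (\<lambda>n. dist (\<mu> n) ?p < \<eta>) at_top"
      using B_subexp[OF \<delta>, of c]
    proof eventually_elim
      case (elim n)
      let ?j = "nat (int n + c)"
      have n: "n > 0" "d \<le> ?j" using elim by linarith+
      have Bpos: "B n ?j > 0" using elim(3) by (meson exp_gt_zero less_le_trans)
      \<comment> \<open>Logarithms in \<open>tilt_bound\<close>, divided by \<open>n\<close>: the
        lower bound on \<open>B\<close> and the constant \<open>eval_fps A 1\<close> cost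
        \<open>\<delta>\<close> each.\<close>
      have main: "u * \<mu> n \<le> 2 * \<delta> + ?p * (exp u - 1)" for u
      proof -
        have "exp (- \<delta> * n) * exp (u * (n * \<mu> n)) \<le> B n ?j * exp (u * (n * \<mu> n))"
          by (intro mult_right_mono elim) simp
        also have "\<dots> \<le> eval_fps A 1 * exp (n * (?p * (exp u - 1)))"
          using tilt_bound[OF Bpos n(2) n(1), of u] by (simp add: \<mu>_def mult_ac)
        also have "\<dots> \<le> exp (\<delta> * n) * exp (n * (?p * (exp u - 1)))"
          by (intro mult_right_mono elim) simp
        finally have "n * (u * \<mu> n) \<le> n * (2 * \<delta> + ?p * (exp u - 1))"
          by (simp add: exp_add[symmetric] algebra_simps)
        then show ?thesis using n by simp
      qed
      have ps: "?p * s\<^sup>2 \<le> s * (\<eta> / 4)"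
      proof -
        have "?p * s\<^sup>2 \<le> 1 * s\<^sup>2" using p1 by (intro mult_right_mono) auto
        also have "\<dots> \<le> s * (\<eta> / 4)" using s by (simp add: power2_eq_square)
        finally show ?thesis .
      qed
      have "s * \<mu> n \<le> 2 * \<delta> + ?p * (s + s\<^sup>2)"
        using main[of s] mult_left_mono[OF up less_imp_le[OF p0]] by linarith
      also have "\<dots> \<le> s * (?p + \<eta> / 2)" using ps by (simp add: \<delta>_def algebra_simps)
      finally have "\<mu> n \<le> ?p + \<eta> / 2" using s by simp
      have "(- s) * \<mu> n \<le> 2 * \<delta> + ?p * (- s + s\<^sup>2)"
        using main[of "- s"] mult_left_mono[OF dn less_imp_le[OF p0]] by linarith
      also have "\<dots> \<le> s * (- ?p + \<eta> / 2)" using ps by (simp add: \<delta>_def algebra_simps)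
      finally have "s * (- \<mu> n) \<le> s * (- ?p + \<eta> / 2)" by simp
      then have "- \<mu> n \<le> - ?p + \<eta> / 2" using s by (metis mult_le_cancel_left_pos)
      with \<open>\<mu> n \<le> ?p + \<eta> / 2\<close> show ?case using \<eta> by (simp add: dist_real_def abs_if)
    qed
  qed
  then have "(\<lambda>n. \<mu> n / ?p) \<longlonglongrightarrow> ?p / ?p" by (intro tendsto_divide tendsto_const) (use p0 in auto)
  then show ?thesis using p0 by (simp add: \<mu>_def)
qed

section \<open>Insensitivity of the coefficients to bounded index shifts\<close>

lemma B_pos: "eventually (\<lambda>n. B (n + a) (nat (int n + c)) > 0) at_top"
proof -
  have "eventually (\<lambda>n. B n (nat (int n + (c - int a))) > 0) at_top"
    using B_subexp[of 1 "c - int a"] by (auto elim!: eventually_mono intro: less_le_trans[OF exp_gt_zero])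
  then have "eventually (\<lambda>n. B (n + a) (nat (int (n + a) + (c - int a))) > 0) at_top"
    by (rule eventually_compose_filterlim[OF _ filterlim_add_const_nat_at_top])
  then show ?thesis by simp
qed

lemma B_step:
  assumes "d \<in> P"
  shows "(\<lambda>n. B (n + a) (nat (int n + (c - int d)))) \<sim>[at_top] (\<lambda>n. B (n + Suc a) (nat (int n + c)))"
proof -
  let ?c = "c - int (Suc a)"
  have "filterlim (\<lambda>n. n + Suc a) at_top (at_top :: nat filter)" by (rule filterlim_add_const_nat_at_top)
  from filterlim_compose[OF B_ratio[OF assms, of ?c] this]
  have "(\<lambda>n. B (n + Suc a - 1) (nat (int (n + Suc a) + ?c) - d) / B (n + Suc a) (nat (int (n + Suc a) + ?c))) \<longlonglongrightarrow> 1" .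
  moreover have "nat (int (n + Suc a) + ?c) - d = nat (int n + (c - int d))" for n by (simp; linarith)
  moreover have "int (n + Suc a) + ?c = int n + c" for n by simp
  ultimately show ?thesis by (intro asymp_equivI') simp
qed

text \<open>Because \<open>0 \<in> P\<close>, \<open>B_step\<close> can change the first index
  alone; combined with a step for \<open>d \<in> P\<close> it changes the second alone by
  \<open>d\<close>. The admissible shifts of the second index form a group containing
  \<open>P\<close>, hence all integers.\<close>

lemma B_shift: "(\<lambda>n. B (n + a) (nat (int n + c))) \<sim>[at_top] (\<lambda>n. B (n + b) (nat (int n + c')))"
proof -
  define g where "g = (\<lambda>a c n. B (n + a) (nat (int n + c)))"
  have step: "g a (c - int d) \<sim>[at_top] g (Suc a) c" if "d \<in> P" for a c d
    unfolding g_def by (rule B_step[OF that])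
  have shift: "g a (c - int d) \<sim>[at_top] g a c" if "d \<in> P" for a c d
    by (rule asymp_equiv_trans[OF step[OF that]]) (use step[OF zero, of a c] in \<open>simp add: asymp_equiv_sym\<close>)
  define I where "I = {z. \<forall>a c. g a (c - z) \<sim>[at_top] g a c}"
  have "I = UNIV"
  proof (rule int_subgroup_eq_UNIV[OF _ _ gcd])
    fix z w assume z: "z \<in> I" and w: "w \<in> I"
    have "g a (c - (z - w)) \<sim>[at_top] g a c" for a c
    proof (rule asymp_equiv_trans)
      have "g a (c + w - z - w) \<sim>[at_top] g a (c + w - z)" using w unfolding I_def by blast
      then show "g a (c - (z - w)) \<sim>[at_top] g a (c + w - z)"
        by (subst asymp_equiv_sym) (simp add: asymp_equiv_sym algebra_simps)
      have "g a (c + w - z) \<sim>[at_top] g a (c + w)" using z unfolding I_def by blast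
      moreover have "g a (c + w - w) \<sim>[at_top] g a (c + w)" using w unfolding I_def by blast
      then have "g a (c + w) \<sim>[at_top] g a c" by (subst asymp_equiv_sym) simp
      ultimately show "g a (c + w - z) \<sim>[at_top] g a c" by (rule asymp_equiv_trans)
    qed
    then show "z - w \<in> I" unfolding I_def by blast
  next
    fix d assume "d \<in> P"
    then show "int d \<in> I" unfolding I_def using shift by blast
  qed
  then have "c - c' \<in> I" for c c' by simp
  then have c: "g a c \<sim>[at_top] g a c'" for a c c'
    unfolding I_def by (metis (no_types, lifting) diff_diff_eq2 add_diff_cancel_left' mem_Collect_eq)
  have a: "g a c \<sim>[at_top] g 0 c" for a c
  proof (induction a)
    case (Suc a)
    have "g (Suc a) c \<sim>[at_top] g a c" using step[OF zero, of a c] by (simp add: asymp_equiv_sym)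
    then show ?case using Suc.IH by (rule asymp_equiv_trans)
  qed simp
  have "g a c \<sim>[at_top] g b c'"
  proof (rule asymp_equiv_trans[OF a])
    show "g 0 c \<sim>[at_top] g b c'"
      by (rule asymp_equiv_trans[OF c]) (use a[of b c'] in \<open>simp add: asymp_equiv_sym\<close>)
  qed
  then show ?thesis unfolding g_def .
qed

end

subsection \<open>Counting maps by exposing preimages\<close>

lemma sum_Pow_card:
  fixes g :: "nat \<Rightarrow> real"
  assumes "finite D"
  shows "(\<Sum>X\<in>Pow D. g (card X)) = (\<Sum>d=0..card D. real (card D choose d) * g d)"
proof -
  have "(\<Sum>X\<in>Pow D. g (card X)) = (\<Sum>d=0..card D. \<Sum>X\<in>{X\<in>Pow D. card X = d}. g (card X))"
    by (rule sum.group[symmetric]) (use assms in \<open>auto intro: card_mono\<close>)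
  also have "\<dots> = (\<Sum>d=0..card D. real (card D choose d) * g d)"
    using n_subsets[OF assms] by (intro sum.cong refl) (simp add: Pow_def)
  finally show ?thesis .
qed

text \<open>With \<open>t\<close> the functions are total on \<open>D\<close>, otherwise partial; sources and targets are kept
  apart because exposing preimages removes vertices from either side independently.\<close>

definition funs :: "nat set \<Rightarrow> bool \<Rightarrow> nat set \<Rightarrow> nat set \<Rightarrow> (nat \<rightharpoonup> nat) set" where
  "funs P t D V = {f. dom f \<subseteq> D \<and> (t \<longrightarrow> dom f = D) \<and> ran f \<subseteq> V \<and> (\<forall>x\<in>V. preimage_card f x \<in> P)}"

lemma finite_funs:
  assumes "finite D" "finite V"
  shows "finite (funs P t D V)"
proof (rule finite_subset)
  show "funs P t D V \<subseteq> (\<Union>D'\<in>Pow D. {m. dom m = D' \<and> ran m \<subseteq> V})" unfolding funs_def by auto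
  show "finite (\<Union>D'\<in>Pow D. {m. dom m = D' \<and> ran m \<subseteq> V})"
    using assms by (auto intro!: finite_set_of_finite_maps dest: finite_subset)
qed

section \<open>Cutting a map along the preimage of a set of targets\<close>

lemma funs_add_apply:
  assumes "g \<in> funs P True X Y" "h \<in> funs P t (D - X) V" "Y \<inter> V = {}"
  shows "y \<notin> V \<Longrightarrow> (g ++ h) x = Some y \<longleftrightarrow> g x = Some y"
    and "y \<notin> Y \<Longrightarrow> (g ++ h) x = Some y \<longleftrightarrow> h x = Some y"
    and "x \<in> X \<Longrightarrow> (g ++ h) x = g x"
    and "x \<notin> X \<Longrightarrow> (g ++ h) x = h x"
proof -
  have *: "x \<in> X \<Longrightarrow> h x = None" "x \<notin> X \<Longrightarrow> g x = None" "g x = Some z \<Longrightarrow> z \<in> Y" "h x = Some z \<Longrightarrow> z \<in> V" for z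
    using assms unfolding funs_def by (auto simp: ranI dom_def intro: ranI)
  show "y \<notin> V \<Longrightarrow> (g ++ h) x = Some y \<longleftrightarrow> g x = Some y"
    and "y \<notin> Y \<Longrightarrow> (g ++ h) x = Some y \<longleftrightarrow> h x = Some y"
    and "x \<in> X \<Longrightarrow> (g ++ h) x = g x" and "x \<notin> X \<Longrightarrow> (g ++ h) x = h x"
    using * by (cases "x \<in> X"; auto simp: map_add_def split: option.splits)+
qed

lemma funs_add:
  assumes "g \<in> funs P True X Y" "h \<in> funs P t (D - X) V" "Y \<inter> V = {}" "X \<subseteq> D"
  shows "g ++ h \<in> funs P t D (Y \<union> V)"
    and "{x. \<exists>y\<in>Y. (g ++ h) x = Some y} = X"
    and "(g ++ h) |` X = g" and "(g ++ h) |` (- X) = h"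
proof -
  note ap = funs_add_apply[OF assms(1-3)]
  have g: "dom g = X" "ran g \<subseteq> Y" "\<And>y. y \<in> Y \<Longrightarrow> preimage_card g y \<in> P"
    and h: "dom h \<subseteq> D - X" "t \<Longrightarrow> dom h = D - X" "ran h \<subseteq> V" "\<And>y. y \<in> V \<Longrightarrow> preimage_card h y \<in> P"
    using assms unfolding funs_def by auto
  have "preimage_card (g ++ h) y \<in> P" if "y \<in> Y \<union> V" for y
  proof (cases "y \<in> Y")
    case True
    then have "preimage_card (g ++ h) y = preimage_card g y"
      unfolding preimage_card_def using ap(1) assms(3) by (metis (no_types, lifting) disjoint_iff)
    then show ?thesis using g(3) True by simp
  next
    case False
    then have "preimage_card (g ++ h) y = preimage_card h y"
      unfolding preimage_card_def using ap(2) by simp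
    then show ?thesis using h(4) that False by simp
  qed
  moreover have "ran (g ++ h) \<subseteq> Y \<union> V"
    using g h by (fastforce simp: ran_def map_add_Some_iff)
  ultimately show "g ++ h \<in> funs P t D (Y \<union> V)"
    unfolding funs_def using g h assms(4) by auto
  show "{x. \<exists>y\<in>Y. (g ++ h) x = Some y} = X"
  proof (rule set_eqI)
    fix x
    have "x \<in> {x. \<exists>y\<in>Y. (g ++ h) x = Some y} \<longleftrightarrow> (\<exists>y\<in>Y. g x = Some y)"
      using ap(1) assms(3) by (simp add: disjoint_iff)
    also have "\<dots> \<longleftrightarrow> x \<in> dom g" using g(2) by (auto intro: ranI)
    finally show "x \<in> {x. \<exists>y\<in>Y. (g ++ h) x = Some y} \<longleftrightarrow> x \<in> X" using g(1) by simp
  qed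
  show "(g ++ h) |` X = g"
  proof
    fix x show "((g ++ h) |` X) x = g x"
      using ap(3)[of x] g(1) by (cases "x \<in> X") (auto simp: restrict_map_def dom_def)
  qed
  show "(g ++ h) |` (- X) = h"
  proof
    fix x show "((g ++ h) |` (- X)) x = h x"
      using ap(4)[of x] h(1) by (cases "x \<in> X"; cases "h x") (auto simp: restrict_map_def)
  qed
qed

lemma funs_split:
  assumes f: "f \<in> funs P t D (Y \<union> V)" and disj: "Y \<inter> V = {}"
  defines "X \<equiv> {x. \<exists>y\<in>Y. f x = Some y}"
  shows "X \<subseteq> D" "f |` X \<in> funs P True X Y" "f |` (- X) \<in> funs P t (D - X) V"
    "f |` X ++ f |` (- X) = f"
proof -
  have F: "dom f \<subseteq> D" "t \<Longrightarrow> dom f = D" "ran f \<subseteq> Y \<union> V" "\<And>y. y \<in> Y \<union> V \<Longrightarrow> preimage_card f y \<in> P"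
    using f unfolding funs_def by auto
  show "X \<subseteq> D" using F(1) unfolding X_def by auto
  have "preimage_card (f |` X) y = preimage_card f y" if "y \<in> Y" for y
    unfolding preimage_card_def using that by (intro arg_cong[of _ _ card]) (auto simp: X_def restrict_map_def)
  moreover have "ran (f |` X) \<subseteq> Y" unfolding ran_def X_def by (auto simp: restrict_map_def split: if_splits)
  moreover have "dom (f |` X) = X" unfolding X_def by (auto simp: restrict_map_def split: if_splits)
  ultimately show "f |` X \<in> funs P True X Y" unfolding funs_def using F(4) by auto
  have "preimage_card (f |` (- X)) y = preimage_card f y" if "y \<in> V" for y
    unfolding preimage_card_def using that disj
    by (intro arg_cong[of _ _ card]) (auto simp: X_def restrict_map_def)
  moreover have "ran (f |` (- X)) \<subseteq> V"
    using F(3) unfolding ran_def X_def by (auto simp: restrict_map_def split: if_splits)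
  moreover have "dom (f |` (- X)) = dom f - X" by auto
  ultimately show "f |` (- X) \<in> funs P t (D - X) V" unfolding funs_def using F by auto
  show "f |` X ++ f |` (- X) = f"
    by (auto simp: map_add_def restrict_map_def split: option.splits)
qed

text \<open>A map corresponds to the preimage \<open>X\<close> of \<open>Y\<close>, its part on
  \<open>X\<close> and the rest. The part on \<open>X\<close> is total even if the map is partial.
  The property may depend only on \<open>X\<close> and the rest, so the number of choices for
  \<open>g\<close> factors out.\<close>

lemma card_funs_decomp:
  assumes fin: "finite D" "finite Y" "finite V" and disj: "Y \<inter> V = {}"
    and \<Phi>: "\<And>X g h. X \<subseteq> D \<Longrightarrow> g \<in> funs P True X Y \<Longrightarrow> h \<in> funs P t (D - X) V \<Longrightarrow>
      \<Phi> (g ++ h) \<longleftrightarrow> X \<in> S \<and> \<Psi> X h"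
  shows "card {f \<in> funs P t D (Y \<union> V). \<Phi> f} =
    (\<Sum>X\<in>Pow D \<inter> S. card (funs P True X Y) * card {h \<in> funs P t (D - X) V. \<Psi> X h})"
proof -
  let ?S = "SIGMA X:Pow D \<inter> S. funs P True X Y \<times> {h \<in> funs P t (D - X) V. \<Psi> X h}"
  let ?pre = "\<lambda>f. {x. \<exists>y\<in>Y. f x = Some y}"
  have "bij_betw (\<lambda>(X, g, h). g ++ h) ?S {f \<in> funs P t D (Y \<union> V). \<Phi> f}"
  proof (rule bij_betw_byWitness[where f' = "\<lambda>f. (?pre f, f |` ?pre f, f |` (- ?pre f))"])
    show "\<forall>a\<in>?S. (\<lambda>f. (?pre f, f |` ?pre f, f |` (- ?pre f))) ((\<lambda>(X, g, h). g ++ h) a) = a"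
    proof (rule ballI)
      fix a assume "a \<in> ?S"
      then obtain X g h where a: "a = (X, g, h)" "X \<subseteq> D" "g \<in> funs P True X Y" "h \<in> funs P t (D - X) V"
        by auto
      show "(\<lambda>f. (?pre f, f |` ?pre f, f |` (- ?pre f))) ((\<lambda>(X, g, h). g ++ h) a) = a"
        using funs_add(2-4)[OF a(3,4) disj a(2)] by (simp add: a(1))
    qed
    show "\<forall>f\<in>{f \<in> funs P t D (Y \<union> V). \<Phi> f}. (\<lambda>(X, g, h). g ++ h) (?pre f, f |` ?pre f, f |` (- ?pre f)) = f"
      by (auto intro: funs_split(4)[OF _ disj])
    show "(\<lambda>(X, g, h). g ++ h) ` ?S \<subseteq> {f \<in> funs P t D (Y \<union> V). \<Phi> f}"
      using funs_add(1)[OF _ _ disj] \<Phi> by auto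
    show "(\<lambda>f. (?pre f, f |` ?pre f, f |` (- ?pre f))) ` {f \<in> funs P t D (Y \<union> V). \<Phi> f} \<subseteq> ?S"
    proof (rule image_subsetI)
      fix f assume "f \<in> {f \<in> funs P t D (Y \<union> V). \<Phi> f}"
      then have f: "f \<in> funs P t D (Y \<union> V)" "\<Phi> f" by auto
      note s = funs_split[OF f(1) disj]
      have "?pre f \<in> S \<and> \<Psi> (?pre f) (f |` (- ?pre f))"
        using \<Phi>[OF s(1-3)] f(2) s(4) by simp
      then show "(?pre f, f |` ?pre f, f |` (- ?pre f)) \<in> ?S" using s by auto
    qed
  qed
  then have "card {f \<in> funs P t D (Y \<union> V). \<Phi> f} = card ?S" by (simp add: bij_betw_same_card)
  also have "\<dots> = (\<Sum>X\<in>Pow D \<inter> S. card (funs P True X Y \<times> {h \<in> funs P t (D - X) V. \<Psi> X h}))"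
  proof (rule card_SigmaI)
    show "\<forall>X\<in>Pow D \<inter> S. finite (funs P True X Y \<times> {h \<in> funs P t (D - X) V. \<Psi> X h})"
    proof
      fix X assume "X \<in> Pow D \<inter> S"
      then have "finite X" using fin(1) finite_subset by auto
      then have "finite (funs P True X Y)" "finite (funs P t (D - X) V)"
        using fin by (auto intro: finite_funs)
      then show "finite (funs P True X Y \<times> {h \<in> funs P t (D - X) V. \<Psi> X h})" by simp
    qed
  qed (use fin in simp)
  finally show ?thesis by (simp add: card_cartesian_product)
qed

section \<open>Numbers of maps as coefficients of power series\<close>

lemma card_funs_singleton:
  assumes "finite X"
  shows "card (funs P True X {y}) = (if card X \<in> P then 1 else 0)"
proof -
  let ?f = "\<lambda>x. if x \<in> X then Some y else None"
  define g where "g = ?f"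
  have "f = g" if "f \<in> funs P True X {y}" for f
  proof
    fix x show "f x = g x" using that unfolding funs_def g_def by (cases "f x") (auto simp: dom_def ran_def)
  qed
  moreover have "preimage_card g y = card X" "dom g = X" "ran g \<subseteq> {y}"
    by (auto simp: g_def preimage_card_def ran_def split: if_splits)
  then have "g \<in> funs P True X {y} \<longleftrightarrow> card X \<in> P" by (simp add: funs_def)
  ultimately have "funs P True X {y} = (if card X \<in> P then {g} else {})" by auto
  then show ?thesis by simp
qed

lemma card_funs_empty:
  "card (funs P t D {}) = (if t \<and> D \<noteq> {} then 0 else 1)"
proof -
  have "ran f \<subseteq> {} \<longleftrightarrow> f = Map.empty" for f :: "nat \<rightharpoonup> nat"
    using dom_eq_empty_conv[of f] by (auto simp: ran_def dom_def)
  then have "funs P t D {} = (if t \<and> D \<noteq> {} then {} else {Map.empty})"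
    unfolding funs_def by auto
  then show ?thesis by simp
qed

text \<open>Boltzmann weights at parameter \<open>\<tau>\<close>. They form a probability law when
  \<open>e = eP P \<tau>\<close>, but the counting identities hold for every positive
  \<open>e\<close>.\<close>

definition boltzmann :: "nat set \<Rightarrow> real \<Rightarrow> real \<Rightarrow> real fps" where
  "boltzmann P \<tau> e = Abs_fps (\<lambda>d. if d \<in> P then \<tau> ^ d / (fact d * e) else 0)"

text \<open>The series of the set of sources without image: empty for total maps, arbitrary for
  partial ones.\<close>

definition outer :: "bool \<Rightarrow> real \<Rightarrow> real fps" where
  "outer t \<tau> = (if t then 1 else fps_exp \<tau>)"

text \<open>Removing one target together with its preimage gives a binomial convolution, which is
  one multiplication by \<open>boltzmann P \<tau> e\<close>; the scalings by \<open>\<tau>\<close>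
  and \<open>e\<close> cancel.\<close>

lemma card_funs:
  assumes "finite V" "finite D" "\<tau> > 0" "e > 0"
  shows "real (card (funs P t D V)) = fact (card D) * e ^ card V / \<tau> ^ card D *
    fps_nth (outer t \<tau> * boltzmann P \<tau> e ^ card V) (card D)"
  using assms(1,2)
proof (induction V arbitrary: D)
  case empty
  then show ?case using \<open>\<tau> > 0\<close> by (simp add: card_funs_empty outer_def fps_one_nth)
next
  case (insert y V)
  let ?b = "\<lambda>m j. fps_nth (outer t \<tau> * boltzmann P \<tau> e ^ m) j"
  let ?m = "card V" and ?s = "card D"
  let ?g = "\<lambda>d. (if d \<in> P then 1 else 0) * (fact (?s - d) * e ^ ?m / \<tau> ^ (?s - d) * ?b ?m (?s - d))"
  have "card (funs P t D (insert y V)) = card {f \<in> funs P t D ({y} \<union> V). True}" by simp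
  also have "\<dots> = (\<Sum>X\<in>Pow D \<inter> UNIV. card (funs P True X {y}) * card {h \<in> funs P t (D - X) V. True})"
    by (rule card_funs_decomp) (use insert in auto)
  finally have "real (card (funs P t D (insert y V))) = (\<Sum>X\<in>Pow D. real (card (funs P True X {y})) * real (card (funs P t (D - X) V)))"
    by simp
  also have "\<dots> = (\<Sum>X\<in>Pow D. ?g (card X))"
  proof (intro sum.cong refl)
    fix X assume "X \<in> Pow D"
    then have "finite X" using insert.prems finite_subset by auto
    then have "card (D - X) = ?s - card X" "finite (D - X)"
      using insert.prems \<open>X \<in> Pow D\<close> by (auto simp: card_Diff_subset)
    then show "real (card (funs P True X {y})) * real (card (funs P t (D - X) V)) = ?g (card X)"
      using insert.IH[of "D - X"] card_funs_singleton[OF \<open>finite X\<close>, of P y] by simp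
  qed
  also have "\<dots> = (\<Sum>d=0..?s. real (?s choose d) * ?g d)" by (rule sum_Pow_card[OF insert.prems])
  also have "\<dots> = (\<Sum>d=0..?s. fact ?s * e ^ Suc ?m / \<tau> ^ ?s * (fps_nth (boltzmann P \<tau> e) d * ?b ?m (?s - d)))"
  proof (intro sum.cong refl)
    fix d assume "d \<in> {0..?s}"
    then have d: "d \<le> ?s" by simp
    have "\<tau> ^ ?s = \<tau> ^ d * \<tau> ^ (?s - d)" using d by (simp add: power_add[symmetric])
    then show "real (?s choose d) * ?g d = fact ?s * e ^ Suc ?m / \<tau> ^ ?s * (fps_nth (boltzmann P \<tau> e) d * ?b ?m (?s - d))"
      using assms(3,4) binomial_fact[OF d, where 'a = real] by (simp add: boltzmann_def field_simps)
  qed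
  also have "\<dots> = fact ?s * e ^ Suc ?m / \<tau> ^ ?s * fps_nth (boltzmann P \<tau> e * (outer t \<tau> * boltzmann P \<tau> e ^ ?m)) ?s"
    by (simp only: sum_distrib_left[symmetric] fps_mult_nth[of "boltzmann P \<tau> e"])
  also have "boltzmann P \<tau> e * (outer t \<tau> * boltzmann P \<tau> e ^ ?m) = outer t \<tau> * boltzmann P \<tau> e ^ card (insert y V)"
    using insert.hyps by (simp add: mult_ac)
  also have "Suc ?m = card (insert y V)" using insert.hyps by simp
  finally show ?case .
qed

text \<open>\<open>short r f k y\<close> says that the tree of iterated preimages of \<open>y\<close> has fewer than \<open>k\<close> levels.
  The clause \<open>x \<noteq> r\<close> is needed because the root \<open>r\<close> stays a source after it has been removed as a
  target; by \<open>short_root_iff\<close> below it changes nothing when \<open>y = r\<close>.\<close>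

fun short :: "nat \<Rightarrow> (nat \<rightharpoonup> nat) \<Rightarrow> nat \<Rightarrow> nat \<Rightarrow> bool" where
  "short r f 0 y \<longleftrightarrow> False"
| "short r f (Suc k) y \<longleftrightarrow> (\<forall>x. f x = Some y \<longrightarrow> x \<noteq> r \<and> short r f k x)"

text \<open>Preimages of \<open>y\<close> under \<open>h\<close> other than \<open>r\<close> lie in
  \<open>V\<close> again, so the recursion never meets a value of \<open>g\<close>; at
  \<open>r\<close> it stops on both sides.\<close>

lemma short_add:
  assumes "g \<in> funs P True X Y" "h \<in> funs P t (insert r V - X) V" "Y \<inter> V = {}" "y \<in> V"
  shows "short r (g ++ h) k y \<longleftrightarrow> short r h k y"
  using assms(4)
proof (induction k arbitrary: y)
  case (Suc k)
  have "y \<notin> Y" using Suc.prems assms(3) by auto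
  then have eq: "(g ++ h) x = Some y \<longleftrightarrow> h x = Some y" for x
    by (rule funs_add_apply(2)[OF assms(1-3)])
  have "short r (g ++ h) k x \<longleftrightarrow> short r h k x" if "h x = Some y" "x \<noteq> r" for x
  proof (rule Suc.IH)
    show "x \<in> V" using that assms(2) unfolding funs_def by auto
  qed
  then show ?case using eq by auto
qed simp

text \<open>The vertices of \<open>Y\<close> are still targets but, apart from \<open>r\<close>, no
  longer sources. The start is \<open>Y = {r}\<close> with \<open>V\<close> all other
  vertices.\<close>

definition short_funs :: "nat set \<Rightarrow> bool \<Rightarrow> nat \<Rightarrow> nat \<Rightarrow> nat set \<Rightarrow> nat set \<Rightarrow> (nat \<rightharpoonup> nat) set" where
  "short_funs P t r k Y V = {f \<in> funs P t (insert r V) (Y \<union> V). \<forall>y\<in>Y. short r f k y}"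

text \<open>Exposing the preimage \<open>X\<close> of \<open>Y\<close> turns the condition on
  \<open>Y\<close> into \<open>r \<notin> X\<close> and the same condition on \<open>X\<close> with
  one level less, which involves only the remaining map.\<close>

lemma card_short_funs_Suc:
  assumes fin: "finite Y" "finite V" and disj: "Y \<inter> V = {}" "r \<notin> V"
  shows "card (short_funs P t r (Suc k) Y V) =
    (\<Sum>X\<in>Pow V. card (funs P True X Y) * card (short_funs P t r k X (V - X)))"
proof -
  have "card (short_funs P t r (Suc k) Y V) = (\<Sum>X\<in>Pow (insert r V) \<inter> {X. r \<notin> X}.
     card (funs P True X Y) * card {h \<in> funs P t (insert r V - X) V. \<forall>x\<in>X. short r h k x})"
    unfolding short_funs_def
  proof (rule card_funs_decomp)
    fix X g h assume X: "X \<subseteq> insert r V" and g: "g \<in> funs P True X Y" and h: "h \<in> funs P t (insert r V - X) V"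
    have dg: "dom g = X" "ran g \<subseteq> Y" using g unfolding funs_def by auto
    have "(\<forall>y\<in>Y. short r (g ++ h) (Suc k) y) \<longleftrightarrow> (\<forall>y\<in>Y. \<forall>x. g x = Some y \<longrightarrow> x \<noteq> r \<and> short r (g ++ h) k x)"
      using funs_add_apply(1)[OF g h disj(1)] disj(1) by (simp add: disjoint_iff)
    also have "\<dots> \<longleftrightarrow> (\<forall>x\<in>X. x \<noteq> r \<and> short r (g ++ h) k x)"
      using dg by (fastforce simp: dom_def ran_def)
    also have "\<dots> \<longleftrightarrow> (\<forall>x\<in>X. x \<noteq> r \<and> short r h k x)"
      using short_add[OF g h disj(1)] X by (meson insert_iff subsetD)
    finally show "(\<forall>y\<in>Y. short r (g ++ h) (Suc k) y) \<longleftrightarrow> X \<in> {X. r \<notin> X} \<and> (\<forall>x\<in>X. short r h k x)"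
      by auto
  qed (use assms in auto)
  also have "Pow (insert r V) \<inter> {X. r \<notin> X} = Pow V" using disj by auto
  also have "(\<Sum>X\<in>Pow V. card (funs P True X Y) * card {h \<in> funs P t (insert r V - X) V. \<forall>x\<in>X. short r h k x}) =
    (\<Sum>X\<in>Pow V. card (funs P True X Y) * card (short_funs P t r k X (V - X)))"
  proof (intro sum.cong refl)
    fix X assume "X \<in> Pow V"
    then have "insert r V - X = insert r (V - X)" "X \<union> (V - X) = V" using disj by auto
    then show "card (funs P True X Y) * card {h \<in> funs P t (insert r V - X) V. \<forall>x\<in>X. short r h k x} =
      card (funs P True X Y) * card (short_funs P t r k X (V - X))"
      unfolding short_funs_def by simp
  qed
  finally show ?thesis .
qed

section \<open>Short preimage trees and iterated images\<close>

lemma map_iter_add: "map_iter (a + b) f = map_iter a f \<circ>\<^sub>m map_iter b f"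
proof (induction a)
  case 0
  show ?case by (auto simp: map_comp_def split: option.splits)
next
  case (Suc a)
  then show ?case by (auto simp: map_comp_def split: option.splits)
qed

text \<open>The tree search fails either through a full chain of \<open>k\<close> steps into
  \<open>y\<close> or by meeting \<open>r\<close> earlier, which is a chain of \<open>j\<close>
  steps from \<open>r\<close>.\<close>

lemma not_short_iff:
  "\<not> short r f k y \<longleftrightarrow> (\<exists>x. map_iter k f x = Some y) \<or> (\<exists>j\<in>{1..k}. map_iter j f r = Some y)"
proof (induction k arbitrary: y)
  case (Suc k)
  have step: "map_iter (Suc j) f x = Some y \<longleftrightarrow> (\<exists>z. map_iter j f x = Some z \<and> f z = Some y)" for j x
    by (simp add: map_comp_Some_iff)
  have "\<not> short r f (Suc k) y \<longleftrightarrow> (\<exists>x. f x = Some y \<and> (x = r \<or> \<not> short r f k x))" by auto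
  also have "\<dots> \<longleftrightarrow> (\<exists>x. map_iter (Suc k) f x = Some y) \<or> (\<exists>j\<in>{0..k}. map_iter (Suc j) f r = Some y)"
  proof -
    have "{0..k} = insert 0 {1..k}" by auto
    then show ?thesis unfolding step Suc.IH by (auto simp del: atLeastAtMost_iff)
  qed
  also have "(\<exists>j\<in>{0..k}. map_iter (Suc j) f r = Some y) \<longleftrightarrow> (\<exists>j\<in>Suc ` {0..k}. map_iter j f r = Some y)" by blast
  also have "Suc ` {0..k} = {1..Suc k}" by (simp add: image_Suc_atLeastAtMost)
  finally show ?case .
qed auto

text \<open>If the root is met again, \<open>y\<close> lies on a cycle; going round it
  \<open>k\<close> times gives at least \<open>k\<close> steps, the last \<open>k\<close> of which
  form the required chain.\<close>

lemma short_root_iff: "\<not> short y f k y \<longleftrightarrow> (\<exists>x. map_iter k f x = Some y)"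
proof -
  have "\<exists>x. map_iter k f x = Some y" if j: "j \<in> {1..k}" "map_iter j f y = Some y" for j
  proof -
    have "map_iter (i * j) f y = Some y" for i
      by (induction i) (use j in \<open>simp_all add: map_iter_add map_comp_Some_iff\<close>)
    then have "map_iter (k * j) f y = Some y" .
    moreover have "k * j = k + k * (j - 1)" using j by (cases j) auto
    ultimately show ?thesis by (metis map_iter_add map_comp_Some_iff)
  qed
  then show ?thesis using not_short_iff by metis
qed

lemma iter_image_iff_not_short:
  assumes "dom f \<subseteq> {1..n}" "y \<in> {1..n}"
  shows "y \<in> iter_image k f n \<longleftrightarrow> \<not> short y f k y"
proof -
  have "x \<in> {1..n}" if x: "map_iter k f x = Some y" for x
  proof (cases k)
    case (Suc k')
    then have "map_iter (k' + 1) f x = Some y" using x by simp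
    then have "x \<in> dom f" unfolding map_iter_add by (auto simp: map_comp_Some_iff)
    then show ?thesis using assms by auto
  qed (use x assms in simp)
  then show ?thesis unfolding short_root_iff iter_image_def by auto
qed

lemma FP_eq: "FP P n = funs P True {1..n} {1..n}" and QP_eq: "QP P n = funs P False {1..n} {1..n}"
  unfolding FP_def QP_def partial_funs_def funs_def by auto

text \<open>Double counting of the pairs of a map and a vertex outside its iterated image;
  \<open>c\<close> may be the same for all \<open>y\<close> since the counts depend only on
  cardinalities.\<close>

lemma avg_image_funs:
  assumes c: "\<And>y. y \<in> {1..n} \<Longrightarrow> real (card (short_funs P t y k {y} ({1..n} - {y}))) = c"
    and pos: "card (funs P t {1..n} {1..n}) > 0"
  shows "avg_image k (funs P t {1..n} {1..n}) n = n * (1 - c / card (funs P t {1..n} {1..n}))"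
proof -
  let ?F = "funs P t {1..n} {1..n}"
  have fin: "finite ?F" by (intro finite_funs) auto
  have eq: "real (card (iter_image k f n)) = real n - (\<Sum>y=1..n. if short y f k y then 1 else 0)" if f: "f \<in> ?F" for f
  proof -
    have F: "dom f \<subseteq> {1..n}" "ran f \<subseteq> {1..n}" using f unfolding funs_def by auto
    have "iter_image k f n \<subseteq> {1..n}"
    proof
      fix y assume "y \<in> iter_image k f n"
      then obtain x where x: "x \<in> {1..n}" "map_iter k f x = Some y" unfolding iter_image_def by auto
      show "y \<in> {1..n}"
        using x F by (cases k) (auto simp: map_comp_Some_iff ran_def)
    qed
    then have "iter_image k f n = {1..n} - {y\<in>{1..n}. short y f k y}"
      using iter_image_iff_not_short[OF F(1)] by auto
    then have "card (iter_image k f n) = card {1..n} - card {y\<in>{1..n}. short y f k y}"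
      by (metis (no_types, lifting) card_Diff_subset finite_atLeastAtMost finite_subset mem_Collect_eq subsetI)
    moreover have "card {y\<in>{1..n}. short y f k y} \<le> card {1..n}" by (rule card_mono) auto
    moreover have "(\<Sum>y=1..n. if short y f k y then 1 else 0) = real (card {y\<in>{1..n}. short y f k y})"
      by (simp add: sum.If_cases Int_def)
    ultimately show ?thesis by simp
  qed
  have "(\<Sum>f\<in>?F. real (card (iter_image k f n))) = (\<Sum>f\<in>?F. real n - (\<Sum>y=1..n. if short y f k y then 1 else 0))"
    by (intro sum.cong refl eq)
  also have "\<dots> = real (card ?F) * real n - (\<Sum>y=1..n. \<Sum>f\<in>?F. if short y f k y then 1 else 0)"
    by (subst sum.swap) (simp add: sum_subtractf)
  also have "(\<Sum>y=1..n. \<Sum>f\<in>?F. if short y f k y then 1 else (0::real)) = (\<Sum>y=1..n. c)"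
  proof (intro sum.cong refl)
    fix y assume y: "y \<in> {1..n}"
    then have "insert y ({1..n} - {y}) = {1..n}" "{y} \<union> ({1..n} - {y}) = {1..n}" by auto
    then have "short_funs P t y k {y} ({1..n} - {y}) = {f\<in>?F. short y f k y}"
      unfolding short_funs_def by simp
    then show "(\<Sum>f\<in>?F. if short y f k y then 1 else 0) = c"
      using c[OF y] fin by (simp add: sum.If_cases Int_def)
  qed
  finally show ?thesis using pos by (simp add: avg_image_def field_simps)
qed

subsection \<open>Convergence to the extinction probability\<close>

text \<open>The limit weights have mass 1 and the weights \<open>W m\<close> at most 1, so no mass
  escapes: beyond a suitable \<open>N\<close> the weights have mass at most
  \<open>\<epsilon> / 4\<close> for all large \<open>m\<close>.\<close>

lemma tendsto_sum_dominated_mass: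
  fixes W v :: "nat \<Rightarrow> nat \<Rightarrow> real"
  assumes W: "\<And>m s. W m s \<ge> 0" "\<And>m. (\<Sum>s\<le>m. W m s) \<le> 1" "\<And>s. (\<lambda>m. W m s) \<longlonglongrightarrow> w s"
    and w: "w sums 1" and v: "\<And>m s. 0 \<le> v m s" "\<And>m s. v m s \<le> 1" "\<And>s. (\<lambda>m. v m s) \<longlonglongrightarrow> u s"
    and L: "(\<lambda>s. w s * u s) sums L"
  shows "(\<lambda>m. \<Sum>s\<le>m. W m s * v m s) \<longlonglongrightarrow> L"
proof (rule tendstoI)
  fix \<epsilon> :: real assume \<epsilon>: "\<epsilon> > 0"
  have "eventually (\<lambda>N. 1 - \<epsilon> / 4 < (\<Sum>s<N. w s)) at_top"
    using order_tendstoD(1)[OF w[unfolded sums_def], of "1 - \<epsilon> / 4"] \<epsilon> by simp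
  moreover have "eventually (\<lambda>N. dist (\<Sum>s<N. w s * u s) L < \<epsilon> / 4) at_top"
    using tendstoD[OF L[unfolded sums_def], of "\<epsilon> / 4"] \<epsilon> by simp
  ultimately obtain N where N: "1 - \<epsilon> / 4 < (\<Sum>s<N. w s)" "dist (\<Sum>s<N. w s * u s) L < \<epsilon> / 4"
    using eventually_happens[OF eventually_conj] by (metis (no_types, lifting) trivial_limit_sequentially)
  have "(\<lambda>m. \<Sum>s<N. W m s) \<longlonglongrightarrow> (\<Sum>s<N. w s)" by (intro tendsto_sum W)
  from order_tendstoD(1)[OF this N(1)]
  have 1: "eventually (\<lambda>m. 1 - \<epsilon> / 4 < (\<Sum>s<N. W m s)) at_top" .
  have "(\<lambda>m. \<Sum>s<N. W m s * v m s) \<longlonglongrightarrow> (\<Sum>s<N. w s * u s)" by (intro tendsto_intros W v)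
  from tendstoD[OF this, of "\<epsilon> / 4"] \<epsilon>
  have 2: "eventually (\<lambda>m. dist (\<Sum>s<N. W m s * v m s) (\<Sum>s<N. w s * u s) < \<epsilon> / 4) at_top" by simp
  show "eventually (\<lambda>m. dist (\<Sum>s\<le>m. W m s * v m s) L < \<epsilon>) at_top"
    using 1 2 eventually_ge_at_top[of N]
  proof eventually_elim
    case (elim m)
    have split: "{..m} = {..<N} \<union> {N..m}" "{..<N} \<inter> {N..m} = {}" using elim(3) by auto
    have sp: "(\<Sum>s\<le>m. f s) = (\<Sum>s<N. f s) + (\<Sum>s=N..m. f s)" for f :: "nat \<Rightarrow> real"
      unfolding split(1) by (rule sum.union_disjoint) (use split in auto)
    have "(\<Sum>s=N..m. W m s * v m s) \<le> (\<Sum>s=N..m. W m s * 1)"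
      by (intro sum_mono mult_left_mono W v)
    then have "(\<Sum>s=N..m. W m s * v m s) \<le> \<epsilon> / 4"
      using sp[of "W m"] W(2)[of m] elim(1) by simp
    moreover have "0 \<le> (\<Sum>s=N..m. W m s * v m s)" by (intro sum_nonneg mult_nonneg_nonneg W v)
    ultimately show ?case using sp[of "\<lambda>s. W m s * v m s"] N(2) elim(2) \<epsilon>
      unfolding dist_real_def by linarith
  qed
qed

context offspring begin

text \<open>Up to the factor in \<open>card_short_funs\<close> below, \<open>h k m r\<close> counts the maps in which \<open>r\<close> exposed
  vertices have preimage trees with fewer than \<open>k\<close> levels, while \<open>m\<close> targets and \<open>m + 1\<close> sources
  are still unexposed. The factor $(m + 1 - s)/(m + 1)$ comes from the one source that is not allowed
  in any of these trees.\<close>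

fun h :: "nat \<Rightarrow> nat \<Rightarrow> nat \<Rightarrow> real" where
  "h 0 m r = (if r = 0 then B m (Suc m) else 0)"
| "h (Suc k) m r = (\<Sum>s\<le>m. fps_nth (p ^ r) s * (real (Suc m - s) / real (Suc m)) * h k (m - s) s)"

lemma sum_B_le: "(\<Sum>s\<le>m. fps_nth (p ^ r) s * B m (Suc m - s)) \<le> B (m + r) (Suc m)"
proof -
  have "(\<Sum>s\<le>m. fps_nth (p ^ r) s * B m (Suc m - s)) \<le> (\<Sum>s=0..Suc m. fps_nth (p ^ r) s * B m (Suc m - s))"
    by (intro sum_mono2) (auto intro!: mult_nonneg_nonneg fps_power_nonneg nonneg B_nonneg)
  then show ?thesis using B_add[of r m "Suc m"] by (simp add: add.commute)
qed

lemma h_bounds: "0 \<le> h k m r" "h k m r \<le> B (m + r) (Suc m)"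
proof -
  have "0 \<le> h k m r \<and> h k m r \<le> B (m + r) (Suc m)"
  proof (induction k arbitrary: m r)
    case (Suc k)
    have "h (Suc k) m r \<le> (\<Sum>s\<le>m. fps_nth (p ^ r) s * B m (Suc m - s))"
      unfolding h.simps
    proof (intro sum_mono)
      fix s assume "s \<in> {..m}"
      then have "m - s + s = m" "Suc (m - s) = Suc m - s" by auto
      then have "h k (m - s) s \<le> B m (Suc m - s)" "0 \<le> h k (m - s) s" using Suc[of "m - s" s] by auto
      then have "fps_nth (p ^ r) s * (real (Suc m - s) / real (Suc m)) * h k (m - s) s
          \<le> fps_nth (p ^ r) s * 1 * B m (Suc m - s)"
        by (intro mult_mono mult_nonneg_nonneg fps_power_nonneg nonneg) auto
      then show "fps_nth (p ^ r) s * (real (Suc m - s) / real (Suc m)) * h k (m - s) s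
          \<le> fps_nth (p ^ r) s * B m (Suc m - s)" by simp
    qed
    moreover have "0 \<le> h (Suc k) m r" unfolding h.simps
      using Suc by (intro sum_nonneg mult_nonneg_nonneg fps_power_nonneg nonneg) auto
    ultimately show ?case using sum_B_le[of r m] by linarith
  qed (auto simp: B_nonneg)
  then show "0 \<le> h k m r" "h k m r \<le> B (m + r) (Suc m)" by auto
qed

section \<open>Extinction probabilities as limits\<close>

fun extinct :: "nat \<Rightarrow> real" where
  "extinct 0 = 0"
| "extinct (Suc k) = eval_fps p (extinct k)"

lemma eval_bounds:
  assumes "0 \<le> q" "q < 1"
  shows "0 \<le> eval_fps p q" "eval_fps p q < 1"
proof -
  have "0 \<le> fps_nth p 0 * q ^ 0" using nonneg by simp
  also have "\<dots> \<le> eval_fps p q" using fps_term_le_eval[OF nonneg rad assms(1)] .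
  finally show "0 \<le> eval_fps p q" .
  obtain m where m: "m \<in> P" "m \<ge> 2" using two by auto
  have "(\<lambda>j. fps_nth p j * 1 ^ j - fps_nth p j * q ^ j) sums (1 - eval_fps p q)"
    using sums_diff[OF sums_eval_fps[of 1 p] sums_eval_fps[of q p]] mass rad by simp
  then have s: "(\<lambda>j. fps_nth p j * (1 - q ^ j)) sums (1 - eval_fps p q)" by (simp add: algebra_simps)
  have "0 < (\<Sum>j. fps_nth p j * (1 - q ^ j))"
  proof (rule suminf_pos2)
    show "summable (\<lambda>j. fps_nth p j * (1 - q ^ j))" using s by (simp add: sums_iff)
    show "0 \<le> fps_nth p j * (1 - q ^ j)" for j
      using assms nonneg by (intro mult_nonneg_nonneg) (auto simp: power_le_one)
    show "0 < fps_nth p m * (1 - q ^ m)"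
      using assms m supp[of m] power_less_one_iff[of q m] by (intro mult_pos_pos) auto
  qed
  then show "eval_fps p q < 1" using s by (simp add: sums_iff)
qed

lemma extinct_bounds: "0 \<le> extinct k \<and> extinct k < 1"
  by (induction k) (simp_all add: eval_bounds)

text \<open>\<open>W m s\<close> plays the role of the probability that the next level has size
  \<open>s\<close>, and \<open>v m s\<close> that of the conditional probability that its trees are
  short. The former converges by \<open>B_shift\<close>, the latter by induction.\<close>

lemma h_limit: "(\<lambda>m. h k m r / B (m + r) (Suc m)) \<longlonglongrightarrow> extinct k ^ r"
proof (induction k arbitrary: r)
  case 0
  have "eventually (\<lambda>m. B m (Suc m) > 0) at_top" using B_pos[of 0 1] by (simp add: nat_add_distrib)
  then have "eventually (\<lambda>m. h 0 m r / B (m + r) (Suc m) = extinct 0 ^ r) at_top"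
    by eventually_elim (simp add: power_0_left)
  then show ?case by (rule tendsto_eventually)
next
  case (Suc k)
  define W where "W = (\<lambda>m s. fps_nth (p ^ r) s * (B m (Suc m - s) / B (m + r) (Suc m)))"
  define v where "v = (\<lambda>m s. real (Suc m - s) / real (Suc m) * (h k (m - s) s / B m (Suc m - s)))"
  have hB: "h k (m - s) s \<le> B m (Suc m - s)" if "s \<le> m" for m s
    using h_bounds(2)[of k "m - s" s] that by (simp add: Suc_diff_le)
  have "(\<lambda>m. \<Sum>s\<le>m. W m s * v m s) \<longlonglongrightarrow> eval_fps p (extinct k) ^ r"
  proof (rule tendsto_sum_dominated_mass)
    show "W m s \<ge> 0" for m s
      unfolding W_def by (intro mult_nonneg_nonneg divide_nonneg_nonneg fps_power_nonneg nonneg B_nonneg)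
    show "(\<Sum>s\<le>m. W m s) \<le> 1" for m
    proof -
      have "(\<Sum>s\<le>m. W m s) = (\<Sum>s\<le>m. fps_nth (p ^ r) s * B m (Suc m - s)) / B (m + r) (Suc m)"
        by (simp add: W_def sum_divide_distrib)
      also have "\<dots> \<le> B (m + r) (Suc m) / B (m + r) (Suc m)"
        by (intro divide_right_mono sum_B_le B_nonneg)
      also have "\<dots> \<le> 1" by simp
      finally show ?thesis .
    qed
    show "(\<lambda>m. W m s) \<longlonglongrightarrow> fps_nth (p ^ r) s" for s
    proof -
      have "(\<lambda>m. B (m + 0) (nat (int m + (1 - int s))) / B (m + r) (nat (int m + 1))) \<longlonglongrightarrow> 1"
        by (rule asymp_equivD_strong[OF B_shift]) (use B_pos[of r 1] in \<open>auto elim: eventually_mono\<close>)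
      moreover have "nat (int m + (1 - int s)) = Suc m - s" "nat (int m + 1) = Suc m" for m by linarith+
      ultimately have "(\<lambda>m. B m (Suc m - s) / B (m + r) (Suc m)) \<longlonglongrightarrow> 1" by simp
      then show ?thesis unfolding W_def using tendsto_mult[OF tendsto_const[of "fps_nth (p ^ r) s"]] by fastforce
    qed
    show "(fps_nth (p ^ r)) sums 1"
      using sums_eval_fps[of 1 "p ^ r"] by (simp add: fps_conv_radius_power_infinity rad eval_fps_power mass)
    show "0 \<le> v m s" for m s
      unfolding v_def by (intro mult_nonneg_nonneg divide_nonneg_nonneg B_nonneg h_bounds) auto
    show "v m s \<le> 1" for m s
    proof (cases "s \<le> m")
      case True
      have "h k (m - s) s / B m (Suc m - s) \<le> 1"
        using divide_right_mono[OF hB[OF True] B_nonneg[of m "Suc m - s"]]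
        by (rule order_trans) simp
      then have "v m s \<le> 1 * 1" unfolding v_def
        by (intro mult_mono divide_nonneg_nonneg h_bounds B_nonneg) auto
      then show ?thesis by simp
    next
      case False then show ?thesis by (simp add: v_def)
    qed
    show "(\<lambda>m. v m s) \<longlonglongrightarrow> extinct k ^ s" for s
    proof -
      have "(\<lambda>m. h k (m - s) s / B (m - s + s) (Suc (m - s))) \<longlonglongrightarrow> extinct k ^ s"
        by (rule filterlim_compose[OF Suc.IH filterlim_minus_const_nat_at_top])
      moreover have "eventually (\<lambda>m. h k (m - s) s / B (m - s + s) (Suc (m - s)) = h k (m - s) s / B m (Suc m - s)) at_top"
        using eventually_ge_at_top[of s] by eventually_elim (simp add: Suc_diff_le)
      ultimately have *: "(\<lambda>m. h k (m - s) s / B m (Suc m - s)) \<longlonglongrightarrow> extinct k ^ s"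
        by (rule Lim_transform_eventually)
      have "(\<lambda>m. (real m + 1 - real s) / (real m + 1)) \<longlonglongrightarrow> 1" by real_asymp
      moreover have "eventually (\<lambda>m. (real m + 1 - real s) / (real m + 1) = real (Suc m - s) / real (Suc m)) at_top"
        using eventually_ge_at_top[of s] by eventually_elim (simp add: of_nat_diff add.commute)
      ultimately have "(\<lambda>m. real (Suc m - s) / real (Suc m)) \<longlonglongrightarrow> 1"
        by (rule Lim_transform_eventually)
      from tendsto_mult[OF this *] show ?thesis by (simp add: v_def)
    qed
    show "(\<lambda>s. fps_nth (p ^ r) s * extinct k ^ s) sums eval_fps p (extinct k) ^ r"
      using sums_eval_fps[of "extinct k" "p ^ r"] by (simp add: fps_conv_radius_power_infinity rad eval_fps_power)
  qed
  moreover have "(\<Sum>s\<le>m. W m s * v m s) = h (Suc k) m r / B (m + r) (Suc m)" for m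
  proof -
    have "W m s * v m s = fps_nth (p ^ r) s * (real (Suc m - s) / real (Suc m)) * h k (m - s) s / B (m + r) (Suc m)"
      if "s \<le> m" for s
    \<comment> \<open>Division by zero yields 0 in \<open>v\<close>; the identity survives because
      \<open>h\<close> is bounded by the vanishing \<open>B\<close>.\<close>
    proof (cases "B m (Suc m - s) = 0")
      case True
      then have "h k (m - s) s = 0" using hB[OF that] h_bounds(1)[of k "m - s" s] by simp
      then show ?thesis by (simp add: v_def)
    next
      case False then show ?thesis by (simp add: v_def W_def mult_ac)
    qed
    then show ?thesis by (simp add: sum_divide_distrib)
  qed
  ultimately show ?case by simp
qed

lemma card_short_funs:
  assumes p: "p = boltzmann P \<tau> e" "A = outer t \<tau>" and pos: "\<tau> > 0" "e > 0"
    and fin: "finite Y" "finite V" and disj: "Y \<inter> V = {}" "r \<notin> V"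
  shows "real (card (short_funs P t r k Y V)) =
    fact (Suc (card V)) * e ^ (card V + card Y) / \<tau> ^ Suc (card V) * h k (card V) (card Y)"
  using fin disj
proof (induction k arbitrary: Y V)
  case 0
  show ?case
  proof (cases "Y = {}")
    case True
    then have "short_funs P t r 0 Y V = funs P t (insert r V) V" by (simp add: short_funs_def)
    then show ?thesis using card_funs[of V "insert r V" \<tau> e P t, folded p] 0 pos True by (simp add: B_def)
  next
    case False
    then have "short_funs P t r 0 Y V = {}" by (auto simp: short_funs_def)
    then show ?thesis using False 0 by simp
  qed
next
  case (Suc k)
  let ?m = "card V" and ?r = "card Y"
  let ?g = "\<lambda>s. (fact s * e ^ ?r / \<tau> ^ s * fps_nth (p ^ ?r) s) *
      (fact (Suc (?m - s)) * e ^ (?m - s + s) / \<tau> ^ Suc (?m - s) * h k (?m - s) s)"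
  have "real (card (short_funs P t r (Suc k) Y V)) =
      (\<Sum>X\<in>Pow V. real (card (funs P True X Y)) * real (card (short_funs P t r k X (V - X))))"
    using card_short_funs_Suc[OF Suc.prems] by simp
  also have "\<dots> = (\<Sum>X\<in>Pow V. ?g (card X))"
  proof (intro sum.cong refl)
    fix X assume X: "X \<in> Pow V"
    then have fX: "finite X" using Suc.prems finite_subset by auto
    have "real (card (short_funs P t r k X (V - X))) = fact (Suc (?m - card X)) *
        e ^ (?m - card X + card X) / \<tau> ^ Suc (?m - card X) * h k (?m - card X) (card X)"
      using Suc.IH[of X "V - X"] fX X Suc.prems by (simp add: card_Diff_subset)
    moreover have "real (card (funs P True X Y)) = fact (card X) * e ^ ?r / \<tau> ^ card X * fps_nth (p ^ ?r) (card X)"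
      using card_funs[of Y X \<tau> e P True, folded p(1)] fX Suc.prems pos by (simp add: outer_def)
    ultimately show "real (card (funs P True X Y)) * real (card (short_funs P t r k X (V - X))) = ?g (card X)"
      by simp
  qed
  also have "\<dots> = (\<Sum>s=0..?m. real (?m choose s) * ?g s)" by (rule sum_Pow_card) (use Suc.prems in simp)
  also have "\<dots> = (\<Sum>s=0..?m. fact (Suc ?m) * e ^ (?m + ?r) / \<tau> ^ Suc ?m *
      (fps_nth (p ^ ?r) s * (real (Suc ?m - s) / real (Suc ?m)) * h k (?m - s) s))"
  proof (intro sum.cong refl)
    fix s assume "s \<in> {0..?m}"
    then have s: "s \<le> ?m" by simp
    have "\<tau> ^ ?m = \<tau> ^ s * \<tau> ^ (?m - s)" using s by (simp add: power_add[symmetric])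
    moreover have "Suc ?m - s = Suc (?m - s)" "?m - s + s = ?m" using s by auto
    moreover have "real (?m choose s) = fact ?m / (fact s * fact (?m - s))" by (rule binomial_fact[OF s])
    \<comment> \<open>The extra factor arises since the binomial counts subsets of the
      \<open>m\<close> vertices of \<open>V\<close>, whereas the factorials count all
      \<open>m + 1\<close> sources.\<close>
    ultimately show "real (?m choose s) * ?g s = fact (Suc ?m) * e ^ (?m + ?r) / \<tau> ^ Suc ?m *
      (fps_nth (p ^ ?r) s * (real (Suc ?m - s) / real (Suc ?m)) * h k (?m - s) s)"
      using pos by (simp add: field_simps power_add del: of_nat_Suc)
  qed
  also have "\<dots> = fact (Suc ?m) * e ^ (?m + ?r) / \<tau> ^ Suc ?m * h (Suc k) ?m ?r"
    by (simp only: sum_distrib_left[symmetric] h.simps atLeast0AtMost)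
  finally show ?case .
qed

lemma avg_image_asymp:
  assumes p: "p = boltzmann P \<tau> e" "A = outer t \<tau>" and pos: "\<tau> > 0" "e > 0"
  shows "(\<lambda>n. avg_image k (funs P t {1..n} {1..n}) n) \<sim>[at_top] (\<lambda>n. real n * (1 - extinct k))"
proof -
  define c where "c = (\<lambda>n. h k (n - 1) 1 / B n n)"
  have "c \<longlonglongrightarrow> extinct k"
  proof -
    have "(\<lambda>n. h k (n - 1) 1 / B (n - 1 + 1) (Suc (n - 1))) \<longlonglongrightarrow> extinct k ^ 1"
      by (rule filterlim_compose[OF h_limit filterlim_minus_const_nat_at_top])
    moreover have "eventually (\<lambda>n. h k (n - 1) 1 / B (n - 1 + 1) (Suc (n - 1)) = c n) at_top"
      using eventually_ge_at_top[of 1] by eventually_elim (simp add: c_def)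
    ultimately show ?thesis by (simp add: Lim_transform_eventually)
  qed
  \<comment> \<open>Convergence yields asymptotic equivalence because \<open>extinct k < 1\<close>
    makes the limit nonzero.\<close>
  then have "(\<lambda>n. 1 - c n) \<sim>[at_top] (\<lambda>_. 1 - extinct k)"
    using extinct_bounds[of k] by (intro tendsto_imp_asymp_equiv_const tendsto_intros) auto
  then have "(\<lambda>n. real n * (1 - c n)) \<sim>[at_top] (\<lambda>n. real n * (1 - extinct k))"
    by (intro asymp_equiv_intros)
  moreover have "eventually (\<lambda>n. avg_image k (funs P t {1..n} {1..n}) n = real n * (1 - c n)) at_top"
    using eventually_ge_at_top[of 1] B_pos[of 0 0]
  proof eventually_elim
    case (elim n)
    let ?F = "funs P t {1..n} {1..n}" and ?K = "fact n * e ^ n / \<tau> ^ n"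
    have F: "real (card ?F) = ?K * B n n" using card_funs[of "{1..n}" "{1..n}" \<tau> e P t, folded p] pos by (simp add: B_def)
    have "?K > 0" using pos by simp
    moreover have "B n n > 0" using elim(2) by simp
    ultimately have "real (card ?F) > 0" unfolding F by (rule mult_pos_pos)
    then have F0: "card ?F > 0" by (simp only: of_nat_0_less_iff)
    have "real (card (short_funs P t y k {y} ({1..n} - {y}))) = ?K * h k (n - 1) 1" if "y \<in> {1..n}" for y
    proof -
      have "card ({1..n} - {y}) = n - 1" "Suc (n - 1) = n" "n - 1 + 1 = n" "card {y} = 1"
        using that elim(1) by simp_all
      note c = this
      have "real (card (short_funs P t y k {y} ({1..n} - {y}))) =
          fact (Suc (n - 1)) * e ^ (n - 1 + 1) / \<tau> ^ Suc (n - 1) * h k (n - 1) 1"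
        using card_short_funs[OF p pos, of "{y}" "{1..n} - {y}" y k] unfolding c(1,4) by simp
      then show ?thesis unfolding c(2,3) .
    qed
    then have "avg_image k ?F n = real n * (1 - ?K * h k (n - 1) 1 / real (card ?F))"
      by (rule avg_image_funs[OF _ F0])
    also have "?K * h k (n - 1) 1 / real (card ?F) = c n" unfolding F c_def using pos by simp
    finally show ?case .
  qed
  ultimately show ?thesis by (rule asymp_equiv_trans[OF asymp_equiv_refl_ev, rotated])
qed

end

subsection \<open>The critical parameter\<close>

definition expP :: "nat set \<Rightarrow> real fps" where
  "expP P = Abs_fps (\<lambda>n. if n \<in> P then 1 / fact n else 0)"

lemma rad_expP: "fps_conv_radius (expP P) = \<infinity>"
  unfolding fps_conv_radius_def
proof (rule conv_radius_inftyI'')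
  fix z :: real
  show "summable (\<lambda>n. fps_nth (expP P) n * z ^ n)"
  proof (rule summable_comparison_test)
    show "summable (\<lambda>n. norm (z ^ n /\<^sub>R fact n))" by (rule summable_norm_exp)
  qed (auto simp: expP_def divide_inverse)
qed

lemma eP_eq: "eP P = eval_fps (expP P)"
  unfolding eP_def eval_fps_def expP_def by (intro ext suminf_cong) auto

lemma DERIV_expP: "(eP P has_real_derivative eval_fps (fps_deriv (expP P)) t) (at t)"
  unfolding eP_eq by (rule has_field_derivative_eval_fps) (simp add: rad_expP)

lemma rad_deriv_infinity:
  fixes f :: "real fps"
  shows "fps_conv_radius f = \<infinity> \<Longrightarrow> fps_conv_radius (fps_deriv f) = \<infinity>"
  using fps_conv_radius_deriv[of f] by simp

text \<open>The function \<open>g\<close> starts at 1 and has derivative \<open>- t\<close> times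
  the second derivative of the series, so it decreases strictly for positive \<open>t\<close>; it
  remains to find a point where it is at most 0.\<close>

lemma tauP_unique:
  assumes zero: "0 \<in> P" and two: "\<exists>m\<in>P. m \<ge> 2"
  shows "\<exists>!t. t > 0 \<and> eP P t - t * deriv (eP P) t = 0"
proof -
  let ?E = "expP P"
  define g where "g = (\<lambda>t. eval_fps ?E t - t * eval_fps (fps_deriv ?E) t)"
  have geq: "eP P t - t * deriv (eP P) t = g t" for t
    using DERIV_imp_deriv[OF DERIV_expP, of P t] by (simp add: g_def eP_eq)
  obtain m where m: "m \<in> P" "m \<ge> 2" using two by auto
  have Dg: "(g has_real_derivative - t * eval_fps (fps_deriv (fps_deriv ?E)) t) (at t)" for t
  proof -
    have "(eval_fps ?E has_real_derivative eval_fps (fps_deriv ?E) t) (at t)"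
      "(eval_fps (fps_deriv ?E) has_real_derivative eval_fps (fps_deriv (fps_deriv ?E)) t) (at t)"
      by (rule has_field_derivative_eval_fps; simp add: rad_expP rad_deriv_infinity)+
    then show ?thesis unfolding g_def
      by (auto intro!: derivative_eq_intros)
  qed
  have neg: "- t * eval_fps (fps_deriv (fps_deriv ?E)) t < 0" if "t > 0" for t
  proof -
    have "Suc (Suc (m - 2)) = m" using m by simp
    then have "0 < fps_nth (fps_deriv (fps_deriv ?E)) (m - 2) * t ^ (m - 2)"
      using m that by (simp add: expP_def)
    also have "\<dots> \<le> eval_fps (fps_deriv (fps_deriv ?E)) t"
    proof (rule fps_term_le_eval)
      show "fps_nth (fps_deriv (fps_deriv ?E)) i \<ge> 0" for i by (simp add: expP_def)
    qed (use that in \<open>simp_all add: rad_expP rad_deriv_infinity\<close>)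
    finally show ?thesis using that by simp
  qed
  have dec: "g t < g s" if "0 < s" "s < t" for s t
    by (rule DERIV_neg_imp_decreasing[OF that(2)]) (use Dg neg that in \<open>meson less_le_trans\<close>)
  have g0: "g 0 = 1" using zero by (simp add: g_def eval_fps_at_0 expP_def)
  \<comment> \<open>Adding 1 cancels the constant term -1, so \<open>f\<close> has nonnegative
    coefficients and one term bounds \<open>1 - g\<close> from below.\<close>
  define f where "f = fps_X * fps_deriv ?E - ?E + 1"
  have fn: "fps_nth f n = (if n = 0 then 0 else (real n - 1) * fps_nth ?E n)" for n
    using zero by (cases n) (auto simp: f_def expP_def algebra_simps)
  have rX: "fps_conv_radius (fps_X * fps_deriv ?E) = \<infinity>"
    by (intro fps_conv_radius_mult_infinity) (auto simp: rad_expP rad_deriv_infinity)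
  have rf1: "fps_conv_radius (fps_X * fps_deriv ?E - ?E) = \<infinity>"
    using fps_conv_radius_diff[of "fps_X * fps_deriv ?E" ?E] rX rad_expP by simp
  have rf: "fps_conv_radius f = \<infinity>"
    using fps_conv_radius_add[of "fps_X * fps_deriv ?E - ?E" 1] rf1 unfolding f_def by simp
  have ef: "eval_fps f t = 1 - g t" for t
    unfolding f_def g_def using rX rf1 rad_expP
    by (simp add: eval_fps_add eval_fps_diff eval_fps_mult rad_deriv_infinity)
  \<comment> \<open>This choice turns \<open>T ^ m / fact m\<close> into \<open>T ^ (m - 1)\<close>,
    which is at least 1.\<close>
  define T where "T = (fact m :: real)"
  have T: "T \<ge> 1" by (simp add: T_def)
  have "1 \<le> (real m - 1) * T ^ (m - 1)"
    using m T one_le_power[OF T, of "m - 1"] mult_mono[of 1 "real m - 1" 1 "T ^ (m - 1)"] by simp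
  also have "\<dots> = fps_nth f m * T ^ m"
    using m power_eq_if[of T m] by (simp add: fn expP_def T_def)
  also have "\<dots> \<le> eval_fps f T"
    by (rule fps_term_le_eval) (use T rf in \<open>auto simp: fn expP_def\<close>)
  finally have gT: "g T \<le> 0" using ef by simp
  have "\<exists>x. 0 \<le> x \<and> x \<le> T \<and> g x = 0"
    by (rule IVT2') (use gT g0 T Dg in \<open>auto intro!: continuous_at_imp_continuous_on DERIV_isCont\<close>)
  then obtain x where x: "0 \<le> x" "g x = 0" by auto
  then have "x > 0" using g0 by (cases "x = 0") auto
  then show ?thesis unfolding geq using x(2) dec by (metis less_irrefl linorder_neqE_linordered_idom)
qed

text \<open>The equation defining \<open>\<tau>\<close> says exactly that the Boltzmann law has mean
  1, as differentiating its generating function at 1 shows.\<close>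

lemma offspring_boltzmann:
  assumes zero: "0 \<in> P" and two: "\<exists>m\<in>P. m \<ge> 2" and gcd: "Gcd P = 1"
    and \<tau>: "\<tau> > 0" "eP P \<tau> - \<tau> * deriv (eP P) \<tau> = 0"
  shows "eP P \<tau> > 0" and "offspring P (boltzmann P \<tau> (eP P \<tau>)) (outer t \<tau>)"
    and "eval_fps (boltzmann P \<tau> (eP P \<tau>)) z = eP P (\<tau> * z) / eP P \<tau>"
proof -
  define e where "e = eP P \<tau>"
  let ?b = "boltzmann P \<tau> e"
  have "1 * \<tau> ^ 0 \<le> eval_fps (expP P) \<tau>"
    using fps_term_le_eval[of "expP P" \<tau> 0] zero \<tau>(1) rad_expP[of P] by (auto simp: expP_def)
  then have e: "e > 0" by (simp add: e_def eP_eq)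
  have nth: "fps_nth ?b n * z ^ n = fps_nth (expP P) n * (\<tau> * z) ^ n / e" for n and z :: real
    by (simp add: boltzmann_def expP_def power_mult_distrib)
  have ss: "(\<lambda>n. fps_nth ?b n * z ^ n) sums (eP P (\<tau> * z) / e)" for z
    unfolding nth eP_eq by (intro sums_divide sums_eval_fps) (simp add: rad_expP)
  then have ev: "eval_fps ?b z = eP P (\<tau> * z) / e" for z by (simp add: eval_fps_def sums_iff)
  have rad: "fps_conv_radius ?b = \<infinity>"
    unfolding fps_conv_radius_def using ss by (intro conv_radius_inftyI'') (auto simp: sums_iff)
  have "(eval_fps ?b has_real_derivative eval_fps (fps_deriv ?b) 1) (at 1)"
    by (rule has_field_derivative_eval_fps) (simp add: rad)
  moreover have "((\<lambda>z. eP P (\<tau> * z) / e) has_real_derivative deriv (eP P) (\<tau> * 1) * \<tau> / e) (at 1)"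
  proof -
    have "(eP P has_real_derivative deriv (eP P) (\<tau> * 1)) (at (\<tau> * 1))"
      using DERIV_expP[of P "\<tau> * 1"] DERIV_imp_deriv by metis
    moreover have "((\<lambda>z. \<tau> * z) has_real_derivative \<tau>) (at 1)" by (auto intro!: derivative_eq_intros)
    ultimately show ?thesis by (intro DERIV_cdivide DERIV_chain2)
  qed
  ultimately have "eval_fps (fps_deriv ?b) 1 = deriv (eP P) (\<tau> * 1) * \<tau> / e"
    using DERIV_unique ev by (metis (no_types, lifting) ext)
  moreover have "deriv (eP P) (\<tau> * 1) * \<tau> = e" using \<tau>(2) by (simp add: e_def mult.commute)
  ultimately have mean: "eval_fps (fps_deriv ?b) 1 = 1" using e by simp
  show "eP P \<tau> > 0" using e by (simp add: e_def)
  show "eval_fps (boltzmann P \<tau> (eP P \<tau>)) z = eP P (\<tau> * z) / eP P \<tau>" using ev by (simp add: e_def)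
  show "offspring P (boltzmann P \<tau> (eP P \<tau>)) (outer t \<tau>)"
    unfolding e_def[symmetric]
  proof
    show "eval_fps ?b 1 = 1" using e ev[of 1] by (simp add: e_def[symmetric])
  qed (use zero two gcd rad mean \<tau>(1) e in \<open>auto simp: boltzmann_def outer_def fps_one_nth\<close>)
qed

theorem theorem7p10:
  fixes P :: "nat set" and k :: nat
  assumes "0 \<in> P" and "\<exists>m\<in>P. m \<ge> 2" and "Gcd P = 1"
  shows "(\<lambda>n. avg_image k (FP P n) n) \<sim>[at_top] (\<lambda>n. real n * (1 - tauk P k / tauP P))
       \<and> (\<lambda>n. avg_image k (QP P n) n) \<sim>[at_top] (\<lambda>n. real n * (1 - tauk P k / tauP P))"
proof -
  define \<tau> where "\<tau> = tauP P"
  have "\<tau> > 0 \<and> eP P \<tau> - \<tau> * deriv (eP P) \<tau> = 0"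
    unfolding \<tau>_def tauP_def by (rule theI'[OF tauP_unique]) (use assms in auto)
  then have \<tau>: "\<tau> > 0" "eP P \<tau> - \<tau> * deriv (eP P) \<tau> = 0" by auto
  note boltz = offspring_boltzmann[OF assms \<tau>]
  have asymp: "(\<lambda>n. avg_image k (funs P t {1..n} {1..n}) n) \<sim>[at_top] (\<lambda>n. real n * (1 - tauk P k / \<tau>))" for t
  proof -
    interpret offspring P "boltzmann P \<tau> (eP P \<tau>)" "outer t \<tau>" by (rule boltz(2))
    \<comment> \<open>Dividing the recursion of \<open>tauk\<close> by \<open>\<tau>\<close> turns
      the factor \<open>rhoP P\<close> into \<open>1 / eP P \<tau>\<close>, which is the recursion
      of \<open>extinct\<close>.\<close>
    have "extinct k = tauk P k / \<tau>" for k
    proof (induction k)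
      case (Suc k)
      then show ?case using \<tau>(1) by (simp add: boltz(3) rhoP_def \<tau>_def[symmetric])
    qed simp
    then show ?thesis using avg_image_asymp[OF refl refl \<tau>(1) boltz(1), of k] by simp
  qed
  show ?thesis using asymp[of True] asymp[of False] unfolding FP_eq QP_eq \<tau>_def by blast
qed

end
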